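(* Let $(X,J)$ be a perfect quasimetric space. Then $D_J$ defines a metric on $X$.
   Context: A quasimetric on a nonempty set $X$ is a function $J:X\times X\to\mathbb{R}$ such that for all $x,y,z\in X$: (1) $J(x,y)\ge 0$; (2) $J(x,y)=0$ iff $x=y$; (3) $J(x,y)=J(y,x)$; (4) $J(x,y)\le\sigma[J(x,z)+J(z,y)]$ for some constant $\sigma\ge1$ independent of $x,y,z$. A map $f:[a,b]\to(X,J)$ is continuous if $J(f(t_n),f(t))\to0$ whenever $t_n\to t$. For $N\in\mathbb{N}$, $\mathcal{P}_N([a,b],(X,J))$ is the set of continuous $f:[a,b]\to(X,J)$ for which there is a partition $a=a_0<a_1<\cdots<a_N=b$ such that for each $i=0,\dots,N-1$: (i) $J$ is a metric on the subset $f([a_i,a_{i+1}])$ (i.e. satisfies the triangle inequality there), and (ii) $f$ restricted to $[a_i,a_{i+1}]$ is Lipschitz, i.e. $J(f(s),f(t))\le C|s-t|$ for some constant $C$. For such $f$ the length is $L_J(f)=\int_a^b|\dot f(t)|_J\,dt$, where $|\dot f(t)|_J=\lim_{s\to t}J(f(s),f(t))/|s-t|$ (this limit exists for almost every $t$). For $x,y\in X$ let $Path_N(x,y)=\{f\in\mathcal{P}_N([0,1],(X,J)):f(0)=x,\ f(1)=y\}$, $D_J^{(N)}(x,y)=\inf\{L_J(f):f\in Path_N(x,y)\}$ (equal to $+\infty$ if $Path_N(x,y)$ is empty), and $D_J(x,y)=\lim_{N\to\infty}D_J^{(N)}(x,y)$ (the sequence is nonincreasing in $N$). The quasimetric $J$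 is perfect if for any $x,y\in X$ the value $D_J^{(N)}(x,y)$ is a finite real constant, equal to $D_J(x,y)$, for all sufficiently large $N$ (how large may depend on $x,y$). *)

theory Defs
  imports "HOL-Analysis.Analysis"
begin

definition quasimetric :: "'a set \<Rightarrow> ('a \<Rightarrow> 'a \<Rightarrow> real) \<Rightarrow> bool" where
  "quasimetric X J \<longleftrightarrow>
     X \<noteq> {} \<and>
     (\<forall>x\<in>X. \<forall>y\<in>X. 0 \<le> J x y) \<and>
     (\<forall>x\<in>X. \<forall>y\<in>X. J x y = 0 \<longleftrightarrow> x = y) \<and>
     (\<forall>x\<in>X. \<forall>y\<in>X. J x y = J y x) \<and>
     (\<exists>\<sigma>\<ge>1. \<forall>x\<in>X. \<forall>y\<in>X. \<forall>z\<in>X. J x y \<le> \<sigma> * (J x z + J z y))"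

text \<open>Maps from \<open>[a, b]\<close> to \<open>X\<close> are represented by functions on all of
  \<open>real\<close>; none of the notions below depends on their values outside \<open>[a, b]\<close>.\<close>

definition qm_continuous ::
    "'a set \<Rightarrow> ('a \<Rightarrow> 'a \<Rightarrow> real) \<Rightarrow> real \<Rightarrow> real \<Rightarrow> (real \<Rightarrow> 'a) \<Rightarrow> bool" where
  "qm_continuous X J a b f \<longleftrightarrow>
     f \<in> {a..b} \<rightarrow> X \<and>
     (\<forall>\<tau> t. range \<tau> \<subseteq> {a..b} \<and> t \<in> {a..b} \<and> \<tau> \<longlonglongrightarrow> t
        \<longrightarrow> (\<lambda>n::nat. J (f (\<tau> n)) (f t)) \<longlonglongrightarrow> 0)"

text \<open>On a subset of a quasimetric space, \<open>J\<close> is a metric precisely when the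
  triangle inequality holds; this is the first condition on each piece.\<close>

definition piecewise_paths ::
    "'a set \<Rightarrow> ('a \<Rightarrow> 'a \<Rightarrow> real) \<Rightarrow> nat \<Rightarrow> real \<Rightarrow> real \<Rightarrow> (real \<Rightarrow> 'a) set" where
  "piecewise_paths X J N a b =
     {f. qm_continuous X J a b f \<and>
         (\<exists>p::nat \<Rightarrow> real. p 0 = a \<and> p N = b \<and> (\<forall>i<N. p i < p (Suc i)) \<and>
            (\<forall>i<N.
               (\<forall>u \<in> f ` {p i..p (Suc i)}. \<forall>v \<in> f ` {p i..p (Suc i)}.
                  \<forall>w \<in> f ` {p i..p (Suc i)}. J u w \<le> J u v + J v w) \<and>
               (\<exists>C. \<forall>s \<in> {p i..p (Suc i)}. \<forall>t \<in> {p i..p (Suc i)}.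
                  J (f s) (f t) \<le> C * \<bar>s - t\<bar>)))}"

definition metric_speed ::
    "('a \<Rightarrow> 'a \<Rightarrow> real) \<Rightarrow> real \<Rightarrow> real \<Rightarrow> (real \<Rightarrow> 'a) \<Rightarrow> real \<Rightarrow> real" where
  "metric_speed J a b f t = Lim (at t within {a..b}) (\<lambda>s. J (f s) (f t) / \<bar>s - t\<bar>)"

text \<open>\<^const>\<open>metric_speed\<close> is unspecified where the limit does not exist. For
  piecewise paths this is a null set; the Lebesgue (rather than Borel) measure is used so
  that the values there are irrelevant. Since the speed is nonnegative wherever the limit exists,
  the nonnegative integral is the ordinary one.\<close>

definition path_length_J ::
    "('a \<Rightarrow> 'a \<Rightarrow> real) \<Rightarrow> real \<Rightarrow> real \<Rightarrow> (real \<Rightarrow> 'a) \<Rightarrow> ennreal" where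
  "path_length_J J a b f = (\<integral>\<^sup>+ t\<in>{a..b}. ennreal (metric_speed J a b f t) \<partial>lebesgue)"

definition paths_between ::
    "'a set \<Rightarrow> ('a \<Rightarrow> 'a \<Rightarrow> real) \<Rightarrow> nat \<Rightarrow> 'a \<Rightarrow> 'a \<Rightarrow> (real \<Rightarrow> 'a) set" where
  "paths_between X J N x y = {f \<in> piecewise_paths X J N 0 1. f 0 = x \<and> f 1 = y}"

text \<open>In \<^typ>\<open>ennreal\<close> the infimum of the empty set is \<open>\<infinity>\<close>. For \<open>N = 0\<close>
  there is no partition of \<open>[0, 1]\<close>, so the value is \<open>\<infinity>\<close> as well.\<close>

definition path_dist_N ::
    "'a set \<Rightarrow> ('a \<Rightarrow> 'a \<Rightarrow> real) \<Rightarrow> nat \<Rightarrow> 'a \<Rightarrow> 'a \<Rightarrow> ennreal" where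
  "path_dist_N X J N x y = (INF f\<in>paths_between X J N x y. path_length_J J 0 1 f)"

definition path_dist ::
    "'a set \<Rightarrow> ('a \<Rightarrow> 'a \<Rightarrow> real) \<Rightarrow> 'a \<Rightarrow> 'a \<Rightarrow> ennreal" where
  "path_dist X J x y = lim (\<lambda>N. path_dist_N X J N x y)"

definition perfect_quasimetric :: "'a set \<Rightarrow> ('a \<Rightarrow> 'a \<Rightarrow> real) \<Rightarrow> bool" where
  "perfect_quasimetric X J \<longleftrightarrow>
     quasimetric X J \<and>
     (\<forall>x\<in>X. \<forall>y\<in>X. path_dist X J x y < \<infinity> \<and>
        (\<forall>\<^sub>F N in sequentially. path_dist_N X J N x y = path_dist X J x y))"

end

(* A path f which is C-Lipschitz for a metric has almost everywhere a metric speed: the distance functions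
   t |-> J (f q) (f t), q rational, are Lipschitz, hence differentiable almost everywhere, and the supremum m
   of the moduli of their derivatives is the speed, because J (f s) (f t) lies between the increments of these
   functions and the integral of m over [s, t]. In particular the length of a metric piece is at least the
   distance of its end points, so that the relaxed triangle inequality bounds J x y by a multiple, depending
   on N only, of the length of any path with N pieces from x to y; hence D_J separates points. Reversing and
   joining paths, with affine reparametrization, gives symmetry and the triangle inequality. *)

theory Submission
  imports Defs
begin

text \<open>The triangle inequality holds only inside one piece, so the length of a path with
  several pieces controls \<open>J\<close> between its end points only after repeated use of the
  relaxed inequality. The constant obtained satisfies K(n+1) = sigma (K(n) + 1), which is unbounded
  in the number of pieces, and the bound says nothing in the limit. Perfectness rescues it: D_J(x,y)
  is already the value for some finite N, where the constant is finite. For the same reason joined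
  paths must keep all their break points, so what holds for fixed indices is D^(N+M) <= D^(N) +
  D^(M), and the triangle inequality for D_J is read off along the indices N + N. The
  differentiability of Lipschitz functions comes from measures: if F and x - F(x) are both
  nondecreasing, their Stieltjes measures add up to Lebesgue measure, so both have Radon-Nikodym
  densities. Thus F is the integral of a bounded density, and Vitali's covering theorem
  differentiates that integral.\<close>

subsection \<open>Lebesgue differentiation of bounded functions on the line\<close>

lemma negligible_large_averages:
  fixes k :: "real \<Rightarrow> real"
  assumes [measurable]: "k \<in> borel_measurable borel"
    and k: "\<And>t. 0 \<le> k t" "\<And>t. k t \<le> B" and pq: "0 \<le> p" "p < q"
  shows "negligible {t. k t < p \<and> (\<forall>\<delta>>0. \<exists>s u. s < u \<and> u - s < \<delta> \<and> t \<in> {s..u} \<and>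
           ennreal (q * (u - s)) \<le> (\<integral>\<^sup>+x\<in>{s..u}. k x \<partial>lborel))}" (is "negligible ?E")
  unfolding negligible_on_intervals [of ?E]
proof (intro allI)
  \<comment> \<open>Disjoint Vitali intervals of average at least \<open>q\<close>, chosen in an open \<open>U\<close> that exceeds
    \<open>{k < p}\<close> by at most \<open>\<epsilon>\<close>, have a union \<open>W\<close> with \<open>q |W| \<le> p |W| + B \<epsilon>\<close>.\<close>
  fix l r :: real
  define N where "N = density lborel k"
  have [simp]: "sets N = sets borel" "space N = UNIV" by (auto simp: N_def)
  have N: "emeasure N X = (\<integral>\<^sup>+x\<in>X. k x \<partial>lborel)" if "X \<in> sets borel" for X
    using that by (simp add: N_def emeasure_density)
  define A where "A = {t. k t < p} \<inter> {l..r}"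
  have [measurable]: "A \<in> sets borel" unfolding A_def by measurable
  have "emeasure lborel A \<le> emeasure lborel {l..r}" by (intro emeasure_mono) (auto simp: A_def)
  then have fin_A: "emeasure lborel A < \<infinity>"
    by (metis emeasure_lborel_Icc_eq ennreal_less_top infinity_ennreal_def le_less_trans)
  have B: "0 \<le> B" using k[of 0] by linarith
  show "negligible (?E \<inter> cbox l r)"
    unfolding negligible_outer_le
  proof (intro allI impI)
    fix e :: real assume "e > 0"
    \<comment> \<open>Chosen so that w (q - p) <= B \<epsilon> gives w <= e; the summand 1 covers B
      = 0.\<close>
    define \<epsilon> where "\<epsilon> = e * (q - p) / (B + 1)"
    have "\<epsilon> > 0" using \<open>e > 0\<close> pq B by (simp add: \<epsilon>_def)
    have "A \<in> sets lebesgue" by simp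
    then obtain U where U: "open U" "A \<subseteq> U" "U - A \<in> lmeasurable" "emeasure lebesgue (U - A) < ennreal \<epsilon>"
      using sets_lebesgue_outer_open[of A \<epsilon>] \<open>\<epsilon> > 0\<close> by auto
    have [measurable]: "U \<in> sets borel" using U by simp
    have UA: "emeasure lborel (U - A) < ennreal \<epsilon>"
      using U(4) by simp
    have "emeasure lborel U \<le> emeasure lborel A + emeasure lborel (U - A)"
      using U(2) by (intro order_trans[OF _ emeasure_subadditive]) (auto intro!: emeasure_mono)
    also have "\<dots> < \<infinity>"
      using fin_A order_less_trans[OF UA ennreal_less_top] by simp
    finally have fin_U: "emeasure lborel U < \<infinity>" .
    \<comment> \<open>Pairs of centre and radius, the form that the covering theorem for closed
      balls expects; on the line these balls are the compact intervals.\<close>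
    define K where "K = {(c, \<rho>). 0 < \<rho> \<and> cball c \<rho> \<subseteq> U \<and>
      ennreal (q * (2 * \<rho>)) \<le> (\<integral>\<^sup>+x\<in>cball c \<rho>. k x \<partial>lborel)}"
    obtain C where C: "countable C" "C \<subseteq> K"
      "pairwise (\<lambda>i j. disjnt (cball (fst i) (snd i)) (cball (fst j) (snd j))) C"
      "negligible ((?E \<inter> cbox l r) - (\<Union>i \<in> C. cball (fst i) (snd i)))"
    proof (rule Vitali_covering_theorem_cballs[of K snd "?E \<inter> cbox l r" fst])
      show "0 < snd i" if "i \<in> K" for i using that by (auto simp: K_def)
    next
      fix x d :: real assume x: "x \<in> ?E \<inter> cbox l r" and "0 < d"
      then have "x \<in> A" by (auto simp: A_def)
      with U obtain d' where d': "d' > 0" "ball x d' \<subseteq> U" by (meson openE subsetD)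
      define \<delta> where "\<delta> = min d d'"
      have "\<delta> > 0" using \<open>0 < d\<close> d' by (simp add: \<delta>_def)
      with x obtain s u where su: "s < u" "u - s < \<delta>" "x \<in> {s..u}"
          "ennreal (q * (u - s)) \<le> (\<integral>\<^sup>+x\<in>{s..u}. k x \<partial>lborel)"
        by blast
      have eq: "cball ((s + u) / 2) ((u - s) / 2) = {s..u}"
        by (auto simp: cball_eq_atLeastAtMost field_simps)
      have h: "q * (2 * ((u - s) / 2)) = q * (u - s)" by simp
      have "{s..u} \<subseteq> ball x d'" using su by (auto simp: \<delta>_def dist_real_def)
      then have "((s + u) / 2, (u - s) / 2) \<in> K"
        using su order_trans[OF _ d'(2)] unfolding K_def mem_Collect_eq prod.case eq h by auto
      moreover have "(u - s) / 2 < d" using su by (auto simp: \<delta>_def)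
      ultimately show "\<exists>i. i \<in> K \<and> x \<in> cball (fst i) (snd i) \<and> snd i < d"
        using su eq by (intro exI[of _ "((s + u) / 2, (u - s) / 2)"]) auto
    qed (use that in auto)
    define I where "I i = cball (fst i) (snd i)" for i :: "real \<times> real"
    define W where "W = (\<Union>i\<in>C. I i)"
    have [measurable]: "I i \<in> sets borel" for i by (simp add: I_def)
    have [measurable]: "W \<in> sets borel" using C unfolding W_def by (intro sets.countable_UN') auto
    have disj: "disjoint_family_on I C"
      using C(3) by (auto simp: disjoint_family_on_def pairwise_def I_def disjnt_def)
    have "W \<subseteq> U" using C(2) unfolding W_def I_def K_def by fastforce
    then have "emeasure lborel W \<le> emeasure lborel U" by (intro emeasure_mono) auto
    with fin_U have fin_W: "emeasure lborel W < \<infinity>" by order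
    have "ennreal q * emeasure lborel W = (\<integral>\<^sup>+i. ennreal q * emeasure lborel (I i) \<partial>count_space C)"
      unfolding W_def using C(1) disj by (subst emeasure_UN_countable) (auto simp: nn_integral_cmult)
    also have "\<dots> \<le> (\<integral>\<^sup>+i. emeasure N (I i) \<partial>count_space C)"
    proof (intro nn_integral_mono)
      fix i assume "i \<in> space (count_space C)"
      then have i: "i \<in> K" using C(2) by auto
      have "emeasure lborel (I i) = ennreal (2 * snd i)"
        using i by (auto simp: I_def cball_eq_atLeastAtMost K_def)
      then show "ennreal q * emeasure lborel (I i) \<le> emeasure N (I i)"
        using i pq by (auto simp: N I_def K_def ennreal_mult)
    qed
    also have "\<dots> = emeasure N W"
      unfolding W_def using C(1) disj by (subst emeasure_UN_countable) auto
    also have "\<dots> \<le> (\<integral>\<^sup>+x. ennreal p * indicator W x + ennreal B * indicator (U - A) x \<partial>lborel)"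
    proof (subst N, simp, intro nn_integral_mono)
      fix x
      show "ennreal (k x) * indicator W x \<le> ennreal p * indicator W x + ennreal B * indicator (U - A) x"
      proof (cases "x \<in> A")
        case True then show ?thesis by (auto simp: A_def indicator_def ennreal_leI)
      next
        case False
        have "ennreal (k x) \<le> ennreal p + ennreal B"
          using k(2)[of x] by (simp add: ennreal_leI add_increasing)
        with False \<open>W \<subseteq> U\<close> show ?thesis by (auto simp: indicator_def)
      qed
    qed
    also have "\<dots> = ennreal p * emeasure lborel W + ennreal B * emeasure lborel (U - A)"
      by (subst nn_integral_add) (auto simp: nn_integral_cmult_indicator)
    also have "\<dots> \<le> ennreal p * emeasure lborel W + ennreal B * ennreal \<epsilon>"
      using UA by (intro add_left_mono mult_left_mono) auto
    finally have *: "ennreal q * emeasure lborel W \<le> ennreal p * emeasure lborel W + ennreal B * ennreal \<epsilon>" .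
    define w where "w = measure lborel W"
    have w: "emeasure lborel W = ennreal w" "0 \<le> w"
      using fin_W by (auto simp: w_def emeasure_eq_ennreal_measure)
    have "q * w \<le> p * w + B * \<epsilon>"
      using * pq B \<open>\<epsilon> > 0\<close> w by (simp add: ennreal_mult[symmetric] ennreal_plus[symmetric] del: ennreal_plus)
    then have "w * (q - p) \<le> B * \<epsilon>" by (simp add: algebra_simps)
    also have "\<dots> \<le> e * (q - p)"
      unfolding \<epsilon>_def using B \<open>e > 0\<close> pq by (simp add: divide_simps mult_left_le)
    finally have we: "w \<le> e" using pq by simp
    \<comment> \<open>Vitali intervals cover all but a null set, so adding the missed points does
      not change the measure of \<open>W\<close>.\<close>
    define T where "T = W \<union> ((?E \<inter> cbox l r) - W)"
    have neg: "negligible ((?E \<inter> cbox l r) - W)" using C(4) by (simp add: W_def I_def)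
    have Wm: "W \<in> lmeasurable" using fin_W by (auto intro!: fmeasurableI)
    have "T \<in> lmeasurable" unfolding T_def
      using neg Wm negligible_imp_measurable by blast
    moreover have "measure lebesgue T \<le> e"
    proof -
      have "measure lebesgue T = measure lebesgue W"
        unfolding T_def using neg Wm
        by (intro measure_Un_null_set) (auto simp: negligible_iff_null_sets)
      with we show ?thesis by (simp add: w_def)
    qed
    ultimately show "\<exists>T. ?E \<inter> cbox l r \<subseteq> T \<and> T \<in> lmeasurable \<and> measure lebesgue T \<le> e"
      by (intro exI[of _ T]) (auto simp: T_def)
  qed
qed

text \<open>Countably many exceptional sets suffice, since rationals k t < p < q < k t + e exist for
  every e. The intervals need only contain t, so that t may later be either end point of a
  difference quotient.\<close>

lemma AE_lebesgue_averages_upper: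
  fixes k :: "real \<Rightarrow> real"
  assumes [measurable]: "k \<in> borel_measurable borel"
    and k: "\<And>t. 0 \<le> k t" "\<And>t. k t \<le> B"
  shows "AE t in lebesgue. \<forall>e>0. \<exists>\<delta>>0. \<forall>s u. s < u \<longrightarrow> u - s < \<delta> \<longrightarrow> t \<in> {s..u} \<longrightarrow>
           (\<integral>\<^sup>+x\<in>{s..u}. k x \<partial>lborel) \<le> ennreal ((k t + e) * (u - s))"
proof -
  define E where "E p q = {t. k t < p \<and> (\<forall>\<delta>>0. \<exists>s u. s < u \<and> u - s < \<delta> \<and> t \<in> {s..u} \<and>
           ennreal (q * (u - s)) \<le> (\<integral>\<^sup>+x\<in>{s..u}. k x \<partial>lborel))}" for p q
  have "AE t in lebesgue. \<forall>p\<in>\<rat>. \<forall>q\<in>\<rat>. 0 \<le> p \<longrightarrow> p < q \<longrightarrow> t \<notin> E p q"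
  proof (intro AE_ball_countable' AE_impI countable_rat)
    fix p q :: real assume "0 \<le> p" "p < q"
    then have "negligible (E p q)"
      unfolding E_def using k by (intro negligible_large_averages[where B=B]) auto
    then show "AE t in lebesgue. t \<notin> E p q"
      by (simp add: negligible_iff_null_sets AE_not_in)
  qed
  then show ?thesis
  proof eventually_elim
    fix t assume t: "\<forall>p\<in>\<rat>. \<forall>q\<in>\<rat>. 0 \<le> p \<longrightarrow> p < q \<longrightarrow> t \<notin> E p q"
    show "\<forall>e>0. \<exists>\<delta>>0. \<forall>s u. s < u \<longrightarrow> u - s < \<delta> \<longrightarrow> t \<in> {s..u} \<longrightarrow>
           (\<integral>\<^sup>+x\<in>{s..u}. k x \<partial>lborel) \<le> ennreal ((k t + e) * (u - s))"
    proof (intro allI impI)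
      fix e :: real assume "e > 0"
      then obtain p where p: "p \<in> \<rat>" "k t < p" "p < k t + e" using Rats_dense_in_real[of "k t" "k t + e"] by auto
      then obtain q where q: "q \<in> \<rat>" "p < q" "q < k t + e" using Rats_dense_in_real[of p "k t + e"] by auto
      have "0 \<le> p" using k(1)[of t] p by simp
      then have "t \<notin> E p q" using t p q by blast
      then obtain \<delta> where \<delta>: "\<delta> > 0" "\<And>s u. s < u \<Longrightarrow> u - s < \<delta> \<Longrightarrow> t \<in> {s..u} \<Longrightarrow>
          (\<integral>\<^sup>+x\<in>{s..u}. k x \<partial>lborel) \<le> ennreal (q * (u - s))"
        using p unfolding E_def mem_Collect_eq by (meson nle_le)
      show "\<exists>\<delta>>0. \<forall>s u. s < u \<longrightarrow> u - s < \<delta> \<longrightarrow> t \<in> {s..u} \<longrightarrow>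
           (\<integral>\<^sup>+x\<in>{s..u}. k x \<partial>lborel) \<le> ennreal ((k t + e) * (u - s))"
        using \<delta> q by (intro exI[of _ \<delta>]) (auto intro!: ennreal_leI mult_right_mono order_trans[OF \<delta>(2)])
    qed
  qed
qed

lemma set_integrable_bounded_Icc:
  fixes k :: "real \<Rightarrow> real"
  assumes [measurable]: "k \<in> borel_measurable borel" and k: "\<And>t. \<bar>k t\<bar> \<le> B"
  shows "set_integrable lborel {s..u} k"
  unfolding set_integrable_def
proof (rule Bochner_Integration.integrable_bound)
  show "integrable lborel (\<lambda>x. B * indicator {s..u} x :: real)"
    by (intro integrable_mult_right integrable_real_indicator) (auto simp: emeasure_lborel_Icc_eq)
  show "AE x in lborel. norm (indicat_real {s..u} x *\<^sub>R k x) \<le> norm (B * indicator {s..u} x :: real)"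
    using k by (intro AE_I2) (auto simp: indicator_def intro: order_trans[OF _ abs_ge_self])
qed auto

lemma set_integral_const_Icc:
  "s \<le> u \<Longrightarrow> (LINT x:{s..u}|lborel. c) = c * (u - s :: real)"
  by (simp add: set_lebesgue_integral_def)

lemma nn_set_integral_eq_set_integral:
  fixes k :: "real \<Rightarrow> real"
  assumes "set_integrable M A k" "\<And>t. 0 \<le> k t"
  shows "(\<integral>\<^sup>+x\<in>A. k x \<partial>M) = ennreal (LINT x:A|M. k x)"
  using assms unfolding set_integrable_def set_lebesgue_integral_def
  by (subst nn_integral_eq_integral[symmetric]) (auto intro!: nn_integral_cong simp: indicator_def)

text \<open>The one-sided estimate for averages is applied to the nonnegative functions k + B and B
  - k; the first bounds the difference quotients of F from above, the second from below.\<close>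

proposition lebesgue_differentiation:
  fixes k F :: "real \<Rightarrow> real"
  assumes [measurable]: "k \<in> borel_measurable borel" and k: "\<And>t. \<bar>k t\<bar> \<le> B"
    and F: "\<And>s u. s \<le> u \<Longrightarrow> F u - F s = (LINT x:{s..u}|lborel. k x)"
  shows "AE t in lebesgue. (F has_real_derivative k t) (at t)"
proof -
  have int: "set_integrable lborel {s..u} k" for s u
    by (rule set_integrable_bounded_Icc[OF assms(1) k])
  have int1: "set_integrable lborel {s..u} (\<lambda>x. B)" for s u :: real
    by (rule set_integrable_bounded_Icc[where B=B]) (use k order_trans[OF abs_ge_zero k] in auto)
  have bnd: "0 \<le> k t + B" "k t + B \<le> 2 * B" "0 \<le> B - k t" "B - k t \<le> 2 * B" for t
    using k[of t] by (auto simp: abs_le_iff)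
  have nn: "(\<integral>\<^sup>+x\<in>{s..u}. (k x + B) \<partial>lborel) = ennreal (F u - F s + B * (u - s))"
           "(\<integral>\<^sup>+x\<in>{s..u}. (B - k x) \<partial>lborel) = ennreal (B * (u - s) - (F u - F s))"
    if "s \<le> u" for s u
  proof -
    have "(\<integral>\<^sup>+x\<in>{s..u}. (k x + B) \<partial>lborel) = ennreal (LINT x:{s..u}|lborel. k x + B)"
      by (intro nn_set_integral_eq_set_integral set_integral_add int int1) (use bnd in simp)
    also have "(LINT x:{s..u}|lborel. k x + B) = F u - F s + B * (u - s)"
      using that F by (simp add: set_integral_add int int1 set_integral_const_Icc)
    finally show "(\<integral>\<^sup>+x\<in>{s..u}. (k x + B) \<partial>lborel) = ennreal (F u - F s + B * (u - s))" .
    have "(\<integral>\<^sup>+x\<in>{s..u}. (B - k x) \<partial>lborel) = ennreal (LINT x:{s..u}|lborel. B - k x)"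
      by (intro nn_set_integral_eq_set_integral set_integral_diff int int1) (use bnd in simp)
    also have "(LINT x:{s..u}|lborel. B - k x) = B * (u - s) - (F u - F s)"
      using that F by (simp add: set_integral_diff int int1 set_integral_const_Icc)
    finally show "(\<integral>\<^sup>+x\<in>{s..u}. (B - k x) \<partial>lborel) = ennreal (B * (u - s) - (F u - F s))" .
  qed
  have "AE t in lebesgue. \<forall>e>0. \<exists>\<delta>>0. \<forall>s u. s < u \<longrightarrow> u - s < \<delta> \<longrightarrow> t \<in> {s..u} \<longrightarrow>
           (\<integral>\<^sup>+x\<in>{s..u}. (k x + B) \<partial>lborel) \<le> ennreal ((k t + B + e) * (u - s))"
    using bnd by (intro AE_lebesgue_averages_upper[where B="2*B"]) auto
  moreover have "AE t in lebesgue. \<forall>e>0. \<exists>\<delta>>0. \<forall>s u. s < u \<longrightarrow> u - s < \<delta> \<longrightarrow> t \<in> {s..u} \<longrightarrow>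
           (\<integral>\<^sup>+x\<in>{s..u}. (B - k x) \<partial>lborel) \<le> ennreal ((B - k t + e) * (u - s))"
    using bnd by (intro AE_lebesgue_averages_upper[where B="2*B"]) auto
  ultimately show ?thesis
  proof eventually_elim
    fix t
    assume up: "\<forall>e>0. \<exists>\<delta>>0. \<forall>s u. s < u \<longrightarrow> u - s < \<delta> \<longrightarrow> t \<in> {s..u} \<longrightarrow>
           (\<integral>\<^sup>+x\<in>{s..u}. (k x + B) \<partial>lborel) \<le> ennreal ((k t + B + e) * (u - s))"
      and lo: "\<forall>e>0. \<exists>\<delta>>0. \<forall>s u. s < u \<longrightarrow> u - s < \<delta> \<longrightarrow> t \<in> {s..u} \<longrightarrow>
           (\<integral>\<^sup>+x\<in>{s..u}. (B - k x) \<partial>lborel) \<le> ennreal ((B - k t + e) * (u - s))"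
    show "(F has_real_derivative k t) (at t)"
      unfolding has_field_derivative_iff LIM_eq
    proof (intro allI impI)
      fix r :: real assume "r > 0"
      define e where "e = r / 2"
      have "e > 0" using \<open>r > 0\<close> by (simp add: e_def)
      obtain \<delta>1 where \<delta>1: "\<delta>1 > 0" "\<And>s u. s < u \<Longrightarrow> u - s < \<delta>1 \<Longrightarrow> t \<in> {s..u} \<Longrightarrow>
           (\<integral>\<^sup>+x\<in>{s..u}. (k x + B) \<partial>lborel) \<le> ennreal ((k t + B + e) * (u - s))"
        using up \<open>e > 0\<close> by blast
      obtain \<delta>2 where \<delta>2: "\<delta>2 > 0" "\<And>s u. s < u \<Longrightarrow> u - s < \<delta>2 \<Longrightarrow> t \<in> {s..u} \<Longrightarrow>
           (\<integral>\<^sup>+x\<in>{s..u}. (B - k x) \<partial>lborel) \<le> ennreal ((B - k t + e) * (u - s))"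
        using lo \<open>e > 0\<close> by blast
      have main: "\<bar>(F u - F s) / (u - s) - k t\<bar> \<le> e"
        if "s < u" "u - s < min \<delta>1 \<delta>2" "t \<in> {s..u}" for s u
      proof -
        have "F u - F s + B * (u - s) \<le> (k t + B + e) * (u - s)"
          using \<delta>1(2)[of s u] that nn(1)[of s u] bnd(1)[of t] \<open>e > 0\<close>
          by (simp add: ennreal_le_iff)
        moreover have "B * (u - s) - (F u - F s) \<le> (B - k t + e) * (u - s)"
          using \<delta>2(2)[of s u] that nn(2)[of s u] bnd(3)[of t] \<open>e > 0\<close>
          by (simp add: ennreal_le_iff)
        ultimately show ?thesis using that(1)
          by (simp add: abs_le_iff field_simps)
      qed
      show "\<exists>s>0. \<forall>y. y \<noteq> t \<and> norm (y - t) < s \<longrightarrow> norm ((F y - F t) / (y - t) - k t) < r"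
      proof (intro exI[of _ "min \<delta>1 \<delta>2"] conjI allI impI)
        fix y assume y: "y \<noteq> t \<and> norm (y - t) < min \<delta>1 \<delta>2"
        have "\<bar>(F y - F t) / (y - t) - k t\<bar> \<le> e"
        proof (cases "y < t")
          case True
          have "(F t - F y) / (t - y) = (F y - F t) / (y - t)"
            using True by (simp add: divide_simps) (simp add: algebra_simps)
          then show ?thesis using main[of y t] True y by auto
        next
          case False then show ?thesis using main[of t y] y by auto
        qed
        then show "norm ((F y - F t) / (y - t) - k t) < r" using \<open>r > 0\<close> by (simp add: e_def)
      qed (use \<delta>1 \<delta>2 in auto)
    qed
  qed
qed

subsection \<open>Densities of Lipschitz functions and metric differentiation\<close>

text \<open>On an open interval (l, u) the two Stieltjes measures give F u - F l and (u - l) - (F u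
  - F l), whose sum is u - l, and this characterizes Lebesgue measure. Absolute continuity of both
  summands is then immediate.\<close>

lemma lborel_eq_sum_interval_measure:
  fixes F :: "real \<Rightarrow> real"
  assumes F: "\<And>x y. x \<le> y \<Longrightarrow> F x \<le> F y" "\<And>x y. x \<le> y \<Longrightarrow> F y - F x \<le> y - x"
    and [measurable]: "A \<in> sets borel"
  shows "emeasure lborel A = emeasure (interval_measure F) A + emeasure (interval_measure (\<lambda>x. x - F x)) A"
proof -
  define G where "G x = x - F x" for x
  have G: "G x \<le> G y" if "x \<le> y" for x y using F(2)[OF that] by (simp add: G_def)
  have Lip: "\<bar>F x - F y\<bar> \<le> \<bar>x - y\<bar>" for x y
    using F(1)[of x y] F(2)[of x y] F(1)[of y x] F(2)[of y x] by (cases "x \<le> y") auto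
  have cF: "continuous_on UNIV F"
    unfolding continuous_on_iff dist_real_def using Lip by (meson le_less_trans)
  then have cG: "continuous_on UNIV G" unfolding G_def by (intro continuous_intros)
  define \<mu> where "\<mu> A = emeasure (interval_measure F) A + emeasure (interval_measure G) A" for A
  \<comment> \<open>The sum has to be a measure, not just a set function, before the uniqueness of
    \<open>lborel\<close> applies.\<close>
  define M where "M = measure_of UNIV (sets borel) \<mu>"
  have sets_M: "sets M = sets borel"
    unfolding M_def by (metis sets.sigma_sets_eq sets_measure_of_conv space_borel sets.space_closed)
  have em_M: "emeasure M A = \<mu> A" if "A \<in> sets borel" for A
  proof (rule emeasure_measure_of[OF M_def])
    show "countably_additive (sets M) \<mu>"
      unfolding countably_additive_def sets_M
      by (auto simp: \<mu>_def suminf_add[symmetric] suminf_emeasure)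
  qed (use that in \<open>auto simp: sets_M positive_def \<mu>_def\<close>)
  have "lborel = M"
  proof (rule lborel_eqI)
    fix l u :: real assume "\<And>b. b \<in> Basis \<Longrightarrow> l \<bullet> b \<le> u \<bullet> b"
    then have lu: "l \<le> u" by simp
    \<comment> \<open>Stieltjes measures are computed on half-open intervals; continuity makes the
      right end point a null set, which passes to open ones.\<close>
    have single: "emeasure (interval_measure H) {u} = 0"
      if "\<And>x y. x \<le> y \<Longrightarrow> H x \<le> H y" "continuous_on UNIV H" for H
      using emeasure_interval_measure_Icc[of u u H] that by simp
    have Ioo: "emeasure (interval_measure H) {l<..<u} = ennreal (H u - H l)"
      if H: "\<And>x y. x \<le> y \<Longrightarrow> H x \<le> H y" "continuous_on UNIV H" for H
    proof -
      have "emeasure (interval_measure H) {l<..<u} = emeasure (interval_measure H) ({l<..u} - {u})"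
        by (rule arg_cong2[where f=emeasure]) auto
      also have "\<dots> = emeasure (interval_measure H) {l<..u}"
        using single[OF H] by (intro emeasure_Diff_null_set) (auto simp: null_sets_def)
      also have "\<dots> = ennreal (H u - H l)"
        using H lu by (intro emeasure_interval_measure_Ioc)
          (auto intro: continuous_within_subset simp: continuous_on_eq_continuous_within)
      finally show ?thesis .
    qed
    have "emeasure M (box l u) = ennreal (F u - F l) + ennreal (G u - G l)"
      using Ioo[OF F(1) cF] Ioo[OF G cG] by (simp add: em_M \<mu>_def box_real)
    also have "\<dots> = ennreal (u - l)"
      using F(1)[OF lu] G[OF lu] by (subst ennreal_plus[symmetric]) (auto simp: G_def)
    finally show "emeasure M (box l u) = ennreal (\<Prod>b\<in>Basis. (u - l) \<bullet> b)" by simp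
  qed (simp add: sets_M)
  then have "emeasure lborel A = \<mu> A" using em_M[OF assms(3)] by simp
  then show ?thesis by (simp add: \<mu>_def G_def[abs_def])
qed

text \<open>The densities of the two Stieltjes measures add up to 1 almost everywhere, which forces
  the one of F into [0, 1].\<close>

lemma monotone_lipschitz_density:
  fixes F :: "real \<Rightarrow> real"
  assumes F: "\<And>x y. x \<le> y \<Longrightarrow> F x \<le> F y" "\<And>x y. x \<le> y \<Longrightarrow> F y - F x \<le> y - x"
  obtains k where "k \<in> borel_measurable borel" "\<And>t. 0 \<le> k t" "\<And>t. k t \<le> 1"
    "\<And>s u. s \<le> u \<Longrightarrow> F u - F s = (LINT x:{s..u}|lborel. k x)"
proof -
  define G where "G x = x - F x" for x
  have Lip: "\<bar>F x - F y\<bar> \<le> \<bar>x - y\<bar>" for x y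
    using F(1)[of x y] F(2)[of x y] F(1)[of y x] F(2)[of y x] by (cases "x \<le> y") auto
  have cF: "continuous_on UNIV F"
    unfolding continuous_on_iff dist_real_def using Lip by (meson le_less_trans)
  have sum: "emeasure lborel A = emeasure (interval_measure F) A + emeasure (interval_measure G) A"
    if "A \<in> sets borel" for A
    using lborel_eq_sum_interval_measure[OF F that] by (simp add: G_def[abs_def])
  have "absolutely_continuous lborel (interval_measure F)" "absolutely_continuous lborel (interval_measure G)"
    unfolding absolutely_continuous_def null_sets_def using sum by auto
  then obtain f g where [measurable]: "f \<in> borel_measurable lborel" "g \<in> borel_measurable lborel"
    and f: "density lborel f = interval_measure F" and g: "density lborel g = interval_measure G"
    by (metis sigma_finite_measure.Radon_Nikodym[OF sigma_finite_lborel] sets_interval_measure sets_lborel)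
  have "density lborel (\<lambda>x. f x + g x) = density lborel (\<lambda>_. 1)"
  proof (rule measure_eqI)
    fix A assume "A \<in> sets (density lborel (\<lambda>x. f x + g x))"
    then have A[measurable]: "A \<in> sets borel" by simp
    have "emeasure (density lborel (\<lambda>x. f x + g x)) A = (\<integral>\<^sup>+x. f x * indicator A x + g x * indicator A x \<partial>lborel)"
      by (subst emeasure_density) (auto simp: distrib_right)
    also have "\<dots> = emeasure (density lborel f) A + emeasure (density lborel g) A"
      by (subst nn_integral_add) (auto simp: emeasure_density)
    also have "\<dots> = emeasure (density lborel (\<lambda>_. 1)) A"
      by (simp add: f g sum density_1)
    finally show "emeasure (density lborel (\<lambda>x. f x + g x)) A = emeasure (density lborel (\<lambda>_. 1)) A" .
  qed simp
  then have ae: "AE x in lborel. f x + g x = 1"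
    using sigma_finite_measure.density_unique[OF sigma_finite_lborel, of "\<lambda>x. f x + g x" "\<lambda>_. 1"] by auto
  \<comment> \<open>The truncation alters \<open>f\<close> on a null set only and makes the bounds
    hold at every point, with real values.\<close>
  define k where "k x = enn2real (min 1 (f x))" for x
  have km[measurable]: "k \<in> borel_measurable borel" unfolding k_def by measurable
  have k01: "0 \<le> k t" "k t \<le> 1" for t
    by (auto simp: k_def intro: enn2real_leI)
  have fk: "AE x in lborel. f x = ennreal (k x)"
    using ae
  proof eventually_elim
    fix x assume "f x + g x = 1"
    then have "f x \<le> 1" by (metis add_increasing2 order_refl zero_le)
    then show "f x = ennreal (k x)" by (auto simp: k_def min_def ennreal_enn2real_if top_unique)
  qed
  show thesis
  proof (rule that[OF km k01])
    fix s u :: real assume su: "s \<le> u"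
    have "ennreal (F u - F s) = emeasure (density lborel f) {s..u}"
      using F(1) cF su by (simp add: f emeasure_interval_measure_Icc)
    also have "\<dots> = (\<integral>\<^sup>+x\<in>{s..u}. f x \<partial>lborel)" by (simp add: emeasure_density)
    also have "\<dots> = (\<integral>\<^sup>+x\<in>{s..u}. k x \<partial>lborel)"
      using fk by (intro nn_integral_cong_AE) auto
    also have "\<dots> = ennreal (LINT x:{s..u}|lborel. k x)"
      using k01 by (intro nn_set_integral_eq_set_integral set_integrable_bounded_Icc[where B=1]) auto
    finally show "F u - F s = (LINT x:{s..u}|lborel. k x)"
      using F(1)[OF su] k01
      by (subst (asm) ennreal_inj) (auto simp: set_lebesgue_integral_def intro!: integral_nonneg_AE)
  qed
qed

lemma lipschitz_density:
  fixes F :: "real \<Rightarrow> real"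
  assumes F: "\<And>x y. \<bar>F x - F y\<bar> \<le> C * \<bar>x - y\<bar>" and C: "0 < C"
  obtains k where "k \<in> borel_measurable borel" "\<And>t. \<bar>k t\<bar> \<le> C"
    "\<And>s u. s \<le> u \<Longrightarrow> F u - F s = (LINT x:{s..u}|lborel. k x)"
proof -
  \<comment> \<open>Adding C x makes F nondecreasing with slopes in [0, 2 C], and dividing by 2 C
    makes it 1-Lipschitz. Undoing this turns a density k of H into 2 C k - C for F.\<close>
  define H where "H x = (F x + C * x) / (2 * C)" for x
  have "H x \<le> H y" "H y - H x \<le> y - x" if "x \<le> y" for x y
  proof -
    have "F x - F y \<le> C * (y - x)" "F y - F x \<le> C * (y - x)" using F[of x y] that by auto
    moreover have eq: "H y - H x = (F y - F x + C * (y - x)) / (2 * C)"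
      unfolding H_def diff_divide_distrib[symmetric]
      by (intro arg_cong2[where f="(/)"]) (auto simp: algebra_simps)
    ultimately have "0 \<le> H y - H x" "H y - H x \<le> y - x"
      unfolding eq using C by (simp, subst pos_divide_le_eq, simp, argo)
    then show "H x \<le> H y" "H y - H x \<le> y - x" by auto
  qed
  then obtain k where [measurable]: "k \<in> borel_measurable borel" and k: "\<And>t. 0 \<le> k t" "\<And>t. k t \<le> 1"
    and H: "\<And>s u. s \<le> u \<Longrightarrow> H u - H s = (LINT x:{s..u}|lborel. k x)"
    using monotone_lipschitz_density[of H] by metis
  have int: "set_integrable lborel {s..u} k" for s u
    using k by (intro set_integrable_bounded_Icc[where B=1]) auto
  have int1: "set_integrable lborel {s..u} (\<lambda>x. C)" for s u :: real
    using C by (intro set_integrable_bounded_Icc[where B=C]) auto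
  show thesis
  proof (rule that[of "\<lambda>x. 2 * C * k x - C"])
    show "\<bar>2 * C * k t - C\<bar> \<le> C" for t
      using k[of t] C by (auto simp: abs_le_iff)
    fix s u :: real assume su: "s \<le> u"
    have Hx: "2 * C * H x = F x + C * x" for x using C by (simp add: H_def)
    have "(LINT x:{s..u}|lborel. 2 * C * k x - C) = 2 * C * (H u - H s) - C * (u - s)"
      using su by (simp add: set_integral_diff set_integrable_mult_right int int1 H set_integral_const_Icc)
    then show "F u - F s = (LINT x:{s..u}|lborel. 2 * C * k x - C)"
      using Hx[of u] Hx[of s] by (simp add: right_diff_distrib)
  qed auto
qed

lemma bounded_primitive:
  fixes m :: "real \<Rightarrow> real"
  assumes "m \<in> borel_measurable borel" "\<And>t. \<bar>m t\<bar> \<le> B"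
  obtains M where "\<And>s u. s \<le> u \<Longrightarrow> M u - M s = (LINT x:{s..u}|lborel. m x)"
proof -
  have "set_integrable lborel {s<..<u} m" for s u
    by (rule set_integrable_subset[OF set_integrable_bounded_Icc[OF assms, of s u]]) auto
  then have int: "interval_lebesgue_integrable lborel (ereal s) (ereal u) m" for s u
    unfolding interval_lebesgue_integrable_def by (simp add: einterval_eq)
  \<comment> \<open>The interval integral is oriented, so integrating from 0 yields one primitive on
    the whole line, whatever the order of 0, s and u.\<close>
  show thesis
  proof (rule that[of "\<lambda>t. LBINT x=0..t. m x"])
    fix s u :: real assume "s \<le> u"
    have "(LBINT x=0..s. m x) + (LBINT x=s..u. m x) = (LBINT x=0..u. m x)"
      using interval_integral_sum[of 0 s u m] int[of "min 0 (min s u)" "max 0 (max s u)"]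
      by (simp add: zero_ereal_def)
    then show "(LBINT x=0..u. m x) - (LBINT x=0..s. m x) = (LINT x:{s..u}|lborel. m x)"
      using \<open>s \<le> u\<close> by (simp add: interval_integral_Icc)
  qed
qed

text \<open>The pseudometric d lives on the whole line because a piece will be extended by clamping
  its parameter. The integral bound is kept beside the limit since it is what compares the length of
  a piece with the distance of its end points.\<close>

proposition metric_differentiation:
  fixes d :: "real \<Rightarrow> real \<Rightarrow> real"
  assumes sym: "\<And>s t. d s t = d t s" and tri: "\<And>s t u. d s u \<le> d s t + d t u"
    and lip: "\<And>s t. d s t \<le> C * \<bar>s - t\<bar>"
  obtains m where "m \<in> borel_measurable borel" "\<And>t. 0 \<le> m t" "\<And>t. m t \<le> \<bar>C\<bar> + 1"
    "\<And>s u. s \<le> u \<Longrightarrow> d s u \<le> (LINT x:{s..u}|lborel. m x)"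
    "AE t in lebesgue. ((\<lambda>s. d s t / \<bar>s - t\<bar>) \<longlongrightarrow> m t) (at t)"
proof -
  define B where "B = \<bar>C\<bar> + 1"
  have B: "0 < B" by (simp add: B_def)
  have lipB: "d s t \<le> B * \<bar>s - t\<bar>" for s t
  proof -
    have "C * \<bar>s - t\<bar> \<le> B * \<bar>s - t\<bar>" by (intro mult_right_mono) (auto simp: B_def)
    with lip[of s t] show ?thesis by simp
  qed
  have rev_tri: "\<bar>d q s - d q t\<bar> \<le> d s t" for q s t
    using tri[of q s t] tri[of q t s] sym by (auto simp: abs_le_iff)
  have "\<exists>k. k \<in> borel_measurable borel \<and> (\<forall>t. \<bar>k t\<bar> \<le> B) \<and>
     (\<forall>s u. s \<le> u \<longrightarrow> d q u - d q s = (LINT x:{s..u}|lborel. k x))" for q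
    using lipschitz_density[of "d q" B] B order_trans[OF rev_tri lipB] by metis
  then obtain k where km[measurable]: "\<And>q. k q \<in> borel_measurable borel" and k: "\<And>q t. \<bar>k q t\<bar> \<le> B"
    and dk: "\<And>q s u. s \<le> u \<Longrightarrow> d q u - d q s = (LINT x:{s..u}|lborel. k q x)"
    by metis
  \<comment> \<open>Restricting q to the rationals keeps the supremum Borel and leaves only
    countably many null sets to avoid; density of the rationals recovers arbitrary base
    points.\<close>
  define m where "m t = (SUP q\<in>\<rat>. \<bar>k q t\<bar>)" for t
  have bdd: "bdd_above ((\<lambda>q. \<bar>k q t\<bar>) ` \<rat>)" for t
    using k by (auto simp: bdd_above_def)
  have ne: "(\<rat> :: real set) \<noteq> {}" using Rats_0 by blast
  have mm[measurable]: "m \<in> borel_measurable borel"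
    unfolding m_def using bdd by (intro borel_measurable_cSUP) (auto simp: countable_rat)
  have km_le: "\<bar>k q t\<bar> \<le> m t" if "q \<in> \<rat>" for q t
    unfolding m_def using bdd that by (intro cSUP_upper) auto
  have m0: "0 \<le> m t" for t using km_le[of 0 t] by simp
  have mB: "m t \<le> B" for t unfolding m_def using k ne by (intro cSUP_least) auto
  have m_abs: "\<bar>m t\<bar> \<le> B" for t using m0 mB by simp
  have int: "set_integrable lborel {s..u} m" for s u
    using m_abs by (intro set_integrable_bounded_Icc[where B=B]) auto
  have dm: "d s u \<le> (LINT x:{s..u}|lborel. m x)" if su: "s \<le> u" for s u
  proof (rule field_le_epsilon)
    fix e :: real assume "e > 0"
    \<comment> \<open>Replacing s by q costs d q s twice: d s u <= 2 d q s + (d q u - d q s), and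
      each d q s is at most e / 2.\<close>
    obtain q where q: "q \<in> \<rat>" "s < q" "q < s + e / (2 * B)"
      using Rats_dense_in_real[of s "s + e / (2 * B)"] \<open>e > 0\<close> B by auto
    have "B * \<bar>q - s\<bar> \<le> e / 2" using q B \<open>e > 0\<close> by (simp add: field_simps)
    with lipB[of q s] have qs: "d q s \<le> e / 2" by simp
    have "d q u - d q s = (LINT x:{s..u}|lborel. k q x)" using dk su by simp
    also have "\<dots> \<le> (LINT x:{s..u}|lborel. m x)"
      using k km_le[OF q(1)] by (intro set_integral_mono int set_integrable_bounded_Icc[where B=B])
        (auto simp: abs_le_iff)
    finally have "d q u - d q s \<le> (LINT x:{s..u}|lborel. m x)" .
    moreover have "d s u \<le> d q s + d q u" using tri[of s u q] sym by simp
    ultimately show "d s u \<le> (LINT x:{s..u}|lborel. m x) + e" using qs by linarith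
  qed
  obtain M where M: "\<And>s u. s \<le> u \<Longrightarrow> M u - M s = (LINT x:{s..u}|lborel. m x)"
    using bounded_primitive[OF mm m_abs] by blast
  have dM: "d s t \<le> \<bar>M s - M t\<bar>" for s t
    using dm[of s t] dm[of t s] M[of s t] M[of t s] sym[of s t] by (cases "s \<le> t") auto
  have "AE t in lebesgue. (M has_real_derivative m t) (at t)"
    using M m_abs by (intro lebesgue_differentiation) auto
  moreover have "AE t in lebesgue. \<forall>q\<in>\<rat>. (d q has_real_derivative k q t) (at t)"
    using k dk by (intro AE_ball_countable' lebesgue_differentiation countable_rat) auto
  ultimately have "AE t in lebesgue. ((\<lambda>s. d s t / \<bar>s - t\<bar>) \<longlongrightarrow> m t) (at t)"
  proof eventually_elim
    fix t assume M': "(M has_real_derivative m t) (at t)" and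
      d': "\<forall>q\<in>\<rat>. (d q has_real_derivative k q t) (at t)"
    have lim: "((\<lambda>s. \<bar>f s - f t\<bar> / \<bar>s - t\<bar>) \<longlongrightarrow> \<bar>c\<bar>) (at t)"
      if "(f has_real_derivative c) (at t)" for f c
      using tendsto_rabs[OF that[unfolded has_field_derivative_iff]] by (simp add: abs_divide)
    show "((\<lambda>s. d s t / \<bar>s - t\<bar>) \<longlongrightarrow> m t) (at t)"
    proof (rule order_tendstoI)
      fix a assume "a < m t"
      then obtain q where q: "q \<in> \<rat>" "a < \<bar>k q t\<bar>"
        unfolding m_def using less_cSUP_iff[OF ne bdd] by blast
      have "\<forall>\<^sub>F s in at t. a < \<bar>d q s - d q t\<bar> / \<bar>s - t\<bar>"
        using order_tendstoD(1)[OF lim] d' q by blast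
      then show "\<forall>\<^sub>F s in at t. a < d s t / \<bar>s - t\<bar>"
        by eventually_elim (meson abs_ge_zero divide_right_mono less_le_trans rev_tri)
    next
      fix a assume "m t < a"
      then have "\<forall>\<^sub>F s in at t. \<bar>M s - M t\<bar> / \<bar>s - t\<bar> < a"
        using order_tendstoD(2)[OF lim[OF M']] m0[of t] by auto
      then show "\<forall>\<^sub>F s in at t. d s t / \<bar>s - t\<bar> < a"
        by eventually_elim (meson abs_ge_zero divide_right_mono le_less_trans dM)
    qed
  qed
  with mm m0 mB dm show thesis by (intro that[of m]) (auto simp: B_def)
qed

subsection \<open>Piecewise Lipschitz paths\<close>

text \<open>As a lower integral, the nonnegative integral obeys the next two inequalities for arbitrary integrands,
  so that the measurability of the metric speed never becomes an issue.\<close>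

lemma nn_integral_Un_le:
  fixes f :: "'a \<Rightarrow> ennreal"
  assumes A: "A \<in> sets M"
  shows "(\<integral>\<^sup>+x\<in>A \<union> B. f x \<partial>M) \<le> (\<integral>\<^sup>+x\<in>A. f x \<partial>M) + (\<integral>\<^sup>+x\<in>B. f x \<partial>M)"
  unfolding nn_integral_def[of M "\<lambda>x. f x * indicator (A \<union> B) x"]
proof (rule SUP_least)
  fix g assume "g \<in> {g. simple_function M g \<and> g \<le> (\<lambda>x. f x * indicator (A \<union> B) x)}"
  then have g: "simple_function M g" "\<And>x. g x \<le> f x * indicator (A \<union> B) x"
    by (auto simp: le_fun_def)
  have [measurable]: "g \<in> borel_measurable M" using g(1) by (rule borel_measurable_simple_function)
  note A[measurable]
  have "integral\<^sup>S M g = (\<integral>\<^sup>+x. g x \<partial>M)" using g(1) by (simp add: nn_integral_eq_simple_integral)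
  \<comment> \<open>The simple function \<open>g\<close> is measurable even if \<open>f\<close> is
    not, so it can be split exactly; off \<open>A\<close> it is supported in
    \<open>B\<close>.\<close>
  also have "\<dots> = (\<integral>\<^sup>+x. g x * indicator A x + g x * indicator (space M - A) x \<partial>M)"
    by (intro nn_integral_cong) (auto simp: indicator_def)
  also have "\<dots> = (\<integral>\<^sup>+x\<in>A. g x \<partial>M) + (\<integral>\<^sup>+x\<in>space M - A. g x \<partial>M)"
    by (subst nn_integral_add) auto
  also have "\<dots> \<le> (\<integral>\<^sup>+x\<in>A. f x \<partial>M) + (\<integral>\<^sup>+x\<in>B. f x \<partial>M)"
  proof (intro add_mono nn_integral_mono)
    fix x assume "x \<in> space M"
    then show "g x * indicator A x \<le> f x * indicator A x"
      "g x * indicator (space M - A) x \<le> f x * indicator B x"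
      using g(2)[of x] by (auto simp: indicator_def split: if_splits)
  qed
  finally show "integral\<^sup>S M g \<le> (\<integral>\<^sup>+x\<in>A. f x \<partial>M) + (\<integral>\<^sup>+x\<in>B. f x \<partial>M)" .
qed

lemma nn_integral_real_affine_le:
  fixes c :: real and f :: "real \<Rightarrow> ennreal"
  assumes c: "c \<noteq> 0"
  shows "(\<integral>\<^sup>+x. ennreal \<bar>c\<bar> * f (t + c * x) \<partial>lebesgue) \<le> (\<integral>\<^sup>+x. f x \<partial>lebesgue)"
  unfolding nn_integral_def[of lebesgue "\<lambda>x. ennreal \<bar>c\<bar> * f (t + c * x)"]
proof (rule SUP_least)
  fix g assume "g \<in> {g. simple_function lebesgue g \<and> g \<le> (\<lambda>x. ennreal \<bar>c\<bar> * f (t + c * x))}"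
  then have g: "simple_function lebesgue g" "\<And>x. g x \<le> ennreal \<bar>c\<bar> * f (t + c * x)"
    by (auto simp: le_fun_def)
  have gm[measurable]: "g \<in> borel_measurable lebesgue" using g(1) by (rule borel_measurable_simple_function)
  have inv: "- t / c + (1 / c) * (t + c * x) = x" "t + c * (- t / c + (1 / c) * x) = x" for x
    using c by (auto simp: field_simps)
  have "integral\<^sup>S lebesgue g = (\<integral>\<^sup>+x. g x \<partial>lebesgue)" using g(1) by (simp add: nn_integral_eq_simple_integral)
  \<comment> \<open>The exact change of variables is applied to the measurable minorant
    \<open>g\<close> with the inverse affine map, and only then is \<open>g\<close> compared with
    \<open>f\<close>.\<close>
  also have "\<dots> = (\<integral>\<^sup>+x. ennreal \<bar>1 / c\<bar> * g (- t / c + (1 / c) * x) \<partial>lebesgue)"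
    using c nn_integral_real_affine_lebesgue[OF gm, of "1 / c" "- t / c"]
      lebesgue_affine_measurable[where c="\<lambda>x::real. 1 / c" and t="- t / c"]
    by (subst nn_integral_cmult) (auto intro!: measurable_compose[OF _ gm])
  also have "\<dots> \<le> (\<integral>\<^sup>+x. f x \<partial>lebesgue)"
  proof (intro nn_integral_mono)
    fix x
    have "ennreal \<bar>1 / c\<bar> * g (- t / c + (1 / c) * x) \<le> ennreal \<bar>1 / c\<bar> * (ennreal \<bar>c\<bar> * f x)"
      using g(2)[of "- t / c + (1 / c) * x"] inv(2)[of x] by (intro mult_left_mono) auto
    also have "\<dots> = f x" using c by (simp add: mult.assoc[symmetric] ennreal_mult[symmetric])
    finally show "ennreal \<bar>1 / c\<bar> * g (- t / c + (1 / c) * x) \<le> f x" .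
  qed
  finally show "integral\<^sup>S lebesgue g \<le> (\<integral>\<^sup>+x. f x \<partial>lebesgue)" .
qed

section \<open>Metric pieces and the assembly of paths from them\<close>

definition metric_piece :: "('a \<Rightarrow> 'a \<Rightarrow> real) \<Rightarrow> (real \<Rightarrow> 'a) \<Rightarrow> real \<Rightarrow> real \<Rightarrow> bool" where
  "metric_piece J f c d \<longleftrightarrow>
     (\<forall>u \<in> f ` {c..d}. \<forall>v \<in> f ` {c..d}. \<forall>w \<in> f ` {c..d}. J u w \<le> J u v + J v w) \<and>
     (\<exists>C. \<forall>s \<in> {c..d}. \<forall>t \<in> {c..d}. J (f s) (f t) \<le> C * \<bar>s - t\<bar>)"

lemma metric_piece_lipschitz:
  assumes "metric_piece J f c d"
  obtains C where "\<And>s t. s \<in> {c..d} \<Longrightarrow> t \<in> {c..d} \<Longrightarrow> J (f s) (f t) \<le> C * \<bar>s - t\<bar>"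
proof -
  obtain C where "\<forall>s \<in> {c..d}. \<forall>t \<in> {c..d}. J (f s) (f t) \<le> C * \<bar>s - t\<bar>"
    using assms unfolding metric_piece_def by (elim conjE exE)
  then show thesis by (intro that[of C]) blast
qed

lemma metric_piece_triangle:
  assumes "metric_piece J f c d" "s \<in> {c..d}" "t \<in> {c..d}" "u \<in> {c..d}"
  shows "J (f s) (f u) \<le> J (f s) (f t) + J (f t) (f u)"
  using assms unfolding metric_piece_def by simp

lemma piecewise_paths_iff:
  "f \<in> piecewise_paths X J N a b \<longleftrightarrow> qm_continuous X J a b f \<and>
     (\<exists>p. p 0 = a \<and> p N = b \<and> (\<forall>i<N. p i < p (Suc i)) \<and> (\<forall>i<N. metric_piece J f (p i) (p (Suc i))))"
  unfolding piecewise_paths_def metric_piece_def by blast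

lemma partition_mono:
  fixes p :: "nat \<Rightarrow> real"
  assumes "\<forall>i<N. p i < p (Suc i)" "i \<le> j" "j \<le> N"
  shows "p i \<le> p j"
  using assms(2,3)
proof (induction j rule: dec_induct)
  case (step n) then show ?case using assms(1) by (metis Suc_le_eq Suc_leD less_eq_real_def order_trans)
qed simp

lemma partition_cover:
  fixes p :: "nat \<Rightarrow> real"
  assumes "t \<in> {p 0<..p N}"
  obtains i where "i < N" "t \<in> {p i<..p (Suc i)}"
  using assms
proof (induction N arbitrary: thesis)
  case (Suc N)
  show ?case
  proof (cases "t \<le> p N")
    case True then show ?thesis using Suc by (metis greaterThanAtMost_iff less_Suc_eq)
  next
    case False then show ?thesis using Suc.prems(1)[of N] Suc.prems(2) by auto
  qed
qed simp

lemma quasimetric_nonneg: "quasimetric X J \<Longrightarrow> x \<in> X \<Longrightarrow> y \<in> X \<Longrightarrow> 0 \<le> J x y"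
  by (simp add: quasimetric_def)

lemma quasimetric_refl: "quasimetric X J \<Longrightarrow> x \<in> X \<Longrightarrow> J x x = 0"
  by (simp add: quasimetric_def)

lemma quasimetric_sym: "quasimetric X J \<Longrightarrow> x \<in> X \<Longrightarrow> y \<in> X \<Longrightarrow> J x y = J y x"
  by (simp add: quasimetric_def)

text \<open>A Lipschitz bound gives the limit at points of the piece; elsewhere the filter is
  trivial because the interval is closed. Allowing every t lets the limits be glued over a union of
  pieces.\<close>

lemma metric_piece_tendsto:
  assumes J: "quasimetric X J" and f: "f \<in> {c..d} \<rightarrow> X" and p: "metric_piece J f c d"
  shows "((\<lambda>s. J (f s) (f t)) \<longlongrightarrow> 0) (at t within {c..d})"
proof (cases "t \<in> {c..d}")
  case True
  obtain C where C: "\<And>s t. s \<in> {c..d} \<Longrightarrow> t \<in> {c..d} \<Longrightarrow> J (f s) (f t) \<le> C * \<bar>s - t\<bar>"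
    using metric_piece_lipschitz[OF p] by blast
  show ?thesis
  proof (rule tendsto_sandwich[of "\<lambda>_. 0"])
    show "\<forall>\<^sub>F s in at t within {c..d}. 0 \<le> J (f s) (f t)"
      using f True by (auto simp: eventually_at_filter intro!: always_eventually quasimetric_nonneg[OF J])
    show "\<forall>\<^sub>F s in at t within {c..d}. J (f s) (f t) \<le> C * \<bar>s - t\<bar>"
      using C True by (auto simp: eventually_at_filter intro!: always_eventually)
    show "((\<lambda>s. C * \<bar>s - t\<bar>) \<longlongrightarrow> 0) (at t within {c..d})"
      by (rule tendsto_eq_intros refl | simp)+
  qed simp
next
  case False
  then have "at t within {c..d} = bot" by (metis closed_limpt closed_real_atLeastAtMost trivial_limit_within)
  then show ?thesis by simp
qed

text \<open>Continuity is automatic: limits within finitely many pieces combine to a limit within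
  their union. Constructed paths thus have to be checked piece by piece only.\<close>

lemma piecewise_pathsI:
  assumes J: "quasimetric X J" and f: "f \<in> {a..b} \<rightarrow> X"
    and p: "p 0 = a" "p N = b" "\<And>i. i < N \<Longrightarrow> p i < p (Suc i)"
      "\<And>i. i < N \<Longrightarrow> metric_piece J f (p i) (p (Suc i))"
  shows "f \<in> piecewise_paths X J N a b"
proof -
  have mono: "p i \<le> p j" if "i \<le> j" "j \<le> N" for i j
    using partition_mono[of N p] p(3) that by blast
  have lim: "((\<lambda>s. J (f s) (f t)) \<longlongrightarrow> 0) (at t within {p 0..p n})" if "n \<le> N" for n t
    using that
  proof (induction n)
    case 0
    have "at t within {p 0..p 0} = bot" by (simp add: trivial_limit_within islimpt_finite)
    then show ?case by simp
  next
    case (Suc n)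
    have "{p n..p (Suc n)} \<subseteq> {a..b}"
      using mono[of 0 n] mono[of "Suc n" N] Suc.prems p(1,2) by auto
    then have "f \<in> {p n..p (Suc n)} \<rightarrow> X" using f by auto
    then have "((\<lambda>s. J (f s) (f t)) \<longlongrightarrow> 0) (at t within {p n..p (Suc n)})"
      using Suc.prems by (intro metric_piece_tendsto[OF J] p(4)) auto
    moreover have "{p 0..p (Suc n)} = {p 0..p n} \<union> {p n..p (Suc n)}"
      using mono[of 0 n] mono[of n "Suc n"] Suc.prems by auto
    ultimately show ?case using Suc by (simp add: Lim_within_Un)
  qed
  have "qm_continuous X J a b f"
    unfolding qm_continuous_def
  proof (intro conjI f allI impI)
    fix \<tau> :: "nat \<Rightarrow> real" and t
    assume \<tau>: "range \<tau> \<subseteq> {a..b} \<and> t \<in> {a..b} \<and> \<tau> \<longlonglongrightarrow> t"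
    have "J (f t) (f t) = 0" using \<tau> f by (intro quasimetric_refl[OF J]) auto
    then have "continuous (at t within {a..b}) (\<lambda>s. J (f s) (f t))"
      using lim[of N t] p(1,2) by (simp add: continuous_within)
    then have "(\<lambda>n. J (f (\<tau> n)) (f t)) \<longlonglongrightarrow> J (f t) (f t)"
      using \<tau> by (intro continuous_within_tendsto_compose'[where f="\<lambda>s. J (f s) (f t)"]) auto
    then show "(\<lambda>n. J (f (\<tau> n)) (f t)) \<longlonglongrightarrow> 0" using \<open>J (f t) (f t) = 0\<close> by simp
  qed
  then show ?thesis using p unfolding piecewise_paths_iff by blast
qed

text \<open>The Lipschitz constant is multiplied by |\<beta>|. A negative \<beta> serves reversal,
  and \<beta> = 2 serves the two halves of a joined path.\<close>

lemma metric_piece_affine: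
  fixes \<alpha> \<beta> :: real
  assumes p: "metric_piece J f c' d'" and h: "\<And>s. s \<in> {c..d} \<Longrightarrow> h s = f (\<alpha> + \<beta> * s)"
    and sub: "\<And>s. s \<in> {c..d} \<Longrightarrow> \<alpha> + \<beta> * s \<in> {c'..d'}"
  shows "metric_piece J h c d"
proof -
  obtain C where C: "\<And>s t. s \<in> {c'..d'} \<Longrightarrow> t \<in> {c'..d'} \<Longrightarrow> J (f s) (f t) \<le> C * \<bar>s - t\<bar>"
    using metric_piece_lipschitz[OF p] by blast
  have "J (h s) (h t) \<le> (C * \<bar>\<beta>\<bar>) * \<bar>s - t\<bar>" if "s \<in> {c..d}" "t \<in> {c..d}" for s t
  proof -
    have "(\<alpha> + \<beta> * s) - (\<alpha> + \<beta> * t) = \<beta> * (s - t)" by (simp add: algebra_simps)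
    then show ?thesis using C[OF sub[OF that(1)] sub[OF that(2)]] h that
      by (simp add: abs_mult mult.assoc)
  qed
  moreover have "J (h s) (h u) \<le> J (h s) (h t) + J (h t) (h u)"
    if "s \<in> {c..d}" "t \<in> {c..d}" "u \<in> {c..d}" for s t u
    using that by (simp only: h) (intro metric_piece_triangle[OF p] sub)
  ultimately show ?thesis
    unfolding metric_piece_def ball_simps by blast
qed

section \<open>Existence of the speed and lower bounds for the length\<close>

text \<open>Clamping the parameter to [c, d] is 1-Lipschitz and turns the piece into a pseudometric
  on the whole line, to which metric differentiation applies. Near an interior point the clamp is
  the identity, so the speed there is the one of the path itself.\<close>

lemma metric_piece_speed:
  assumes J: "quasimetric X J" and f: "f \<in> {a..b} \<rightarrow> X" and p: "metric_piece J f c d"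
    and cd: "c < d" "a \<le> c" "d \<le> b"
  shows "AE t in lebesgue. t \<in> {c..d} \<longrightarrow>
           (\<exists>l. ((\<lambda>s. J (f s) (f t) / \<bar>s - t\<bar>) \<longlongrightarrow> l) (at t within {a..b}))" (is ?lim)
    and "ennreal (J (f c) (f d)) \<le> (\<integral>\<^sup>+t\<in>{c..d}. ennreal (metric_speed J a b f t) \<partial>lebesgue)" (is ?len)
proof -
  obtain C where C: "\<And>s t. s \<in> {c..d} \<Longrightarrow> t \<in> {c..d} \<Longrightarrow> J (f s) (f t) \<le> C * \<bar>s - t\<bar>"
    using metric_piece_lipschitz[OF p] by blast
  define cl where "cl s = max c (min d s)" for s
  define D where "D s t = J (f (cl s)) (f (cl t))" for s t
  have cl: "cl s \<in> {c..d}" "\<bar>cl s - cl t\<bar> \<le> \<bar>s - t\<bar>" for s t using cd by (auto simp: cl_def)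
  have cl_id: "cl s = s" if "s \<in> {c..d}" for s using that by (auto simp: cl_def)
  have fcl: "f (cl s) \<in> X" for s using cl(1)[of s] cd f by auto
  obtain m where m: "m \<in> borel_measurable borel" "\<And>t. 0 \<le> m t" "\<And>t. m t \<le> \<bar>\<bar>C\<bar>\<bar> + 1"
    "\<And>s u. s \<le> u \<Longrightarrow> D s u \<le> (LINT x:{s..u}|lborel. m x)"
    "AE t in lebesgue. ((\<lambda>s. D s t / \<bar>s - t\<bar>) \<longlongrightarrow> m t) (at t)"
  proof (rule metric_differentiation[of D "\<bar>C\<bar>"])
    show "D s t = D t s" for s t unfolding D_def using fcl by (intro quasimetric_sym[OF J])
    show "D s u \<le> D s t + D t u" for s t u
      unfolding D_def by (intro metric_piece_triangle[OF p] cl)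
    show "D s t \<le> \<bar>C\<bar> * \<bar>s - t\<bar>" for s t
    proof -
      have "D s t \<le> C * \<bar>cl s - cl t\<bar>" unfolding D_def by (intro C cl)
      also have "\<dots> \<le> \<bar>C\<bar> * \<bar>s - t\<bar>" using cl(2) by (intro mult_mono) auto
      finally show ?thesis .
    qed
  qed (rule that)
  \<comment> \<open>At an end point the limit within {a..b} may also see the neighbouring piece, so
    both end points are discarded as null sets.\<close>
  have "AE t in lebesgue. t \<noteq> c \<and> t \<noteq> d"
    by (intro AE_conjI AE_I'[where N="{c}"] AE_I'[where N="{d}"]) (auto intro!: null_sets_completionI)
  with m(5) have ae: "AE t in lebesgue. t \<in> {c..d} \<longrightarrow>
           ((\<lambda>s. J (f s) (f t) / \<bar>s - t\<bar>) \<longlongrightarrow> m t) (at t within {a..b}) \<and> metric_speed J a b f t = m t"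
  proof eventually_elim
    case (elim t)
    show ?case
    proof
      assume "t \<in> {c..d}"
      with elim have t: "c < t" "t < d" by auto
      have at: "at t within {a..b} = at t" using t cd by (intro at_within_Icc_at) auto
      have "\<forall>\<^sub>F s in at t. s \<in> {c<..<d}" using t by (intro eventually_at_in_open') auto
      then have "\<forall>\<^sub>F s in at t. D s t / \<bar>s - t\<bar> = J (f s) (f t) / \<bar>s - t\<bar>"
        by eventually_elim (use t cl_id in \<open>auto simp: D_def\<close>)
      then have lim: "((\<lambda>s. J (f s) (f t) / \<bar>s - t\<bar>) \<longlongrightarrow> m t) (at t)"
        using elim(1) by (rule Lim_transform_eventually[rotated])
      then show "((\<lambda>s. J (f s) (f t) / \<bar>s - t\<bar>) \<longlongrightarrow> m t) (at t within {a..b}) \<and> metric_speed J a b f t = m t"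
        by (simp add: at metric_speed_def tendsto_Lim)
    qed
  qed
  show ?lim using ae by eventually_elim blast
  have "ennreal (J (f c) (f d)) \<le> ennreal (LINT x:{c..d}|lborel. m x)"
    using m(4)[of c d] cd cl_id by (intro ennreal_leI) (auto simp: D_def)
  also have "\<dots> = (\<integral>\<^sup>+x\<in>{c..d}. m x \<partial>lborel)"
    using m by (intro nn_set_integral_eq_set_integral[symmetric] set_integrable_bounded_Icc[where B="\<bar>C\<bar> + 1"]) auto
  also have "\<dots> = (\<integral>\<^sup>+x\<in>{c..d}. m x \<partial>lebesgue)"
    using m(1) by (subst nn_integral_completion) auto
  also have "\<dots> = (\<integral>\<^sup>+t\<in>{c..d}. ennreal (metric_speed J a b f t) \<partial>lebesgue)"
    using ae by (intro nn_integral_cong_AE) (auto simp: indicator_def)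
  finally show ?len .
qed

lemma piecewise_paths_speed_exists:
  assumes J: "quasimetric X J" and f: "f \<in> piecewise_paths X J N a b"
  shows "AE t in lebesgue. t \<in> {a<..b} \<longrightarrow>
           (\<exists>l. ((\<lambda>s. J (f s) (f t) / \<bar>s - t\<bar>) \<longlongrightarrow> l) (at t within {a..b}))"
proof -
  obtain p where p: "p 0 = a" "p N = b" "\<forall>i<N. p i < p (Suc i)"
      "\<And>i. i < N \<Longrightarrow> metric_piece J f (p i) (p (Suc i))" and fX: "f \<in> {a..b} \<rightarrow> X"
    using f unfolding piecewise_paths_iff qm_continuous_def by blast
  have "AE t in lebesgue. \<forall>i\<in>{..<N}. t \<in> {p i..p (Suc i)} \<longrightarrow>
           (\<exists>l. ((\<lambda>s. J (f s) (f t) / \<bar>s - t\<bar>) \<longlongrightarrow> l) (at t within {a..b}))"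
  proof (intro AE_ball_countable')
    fix i assume "i \<in> {..<N}"
    then have i: "i < N" by simp
    then show "AE t in lebesgue. t \<in> {p i..p (Suc i)} \<longrightarrow>
           (\<exists>l. ((\<lambda>s. J (f s) (f t) / \<bar>s - t\<bar>) \<longlongrightarrow> l) (at t within {a..b}))"
      using p(3) partition_mono[OF p(3), of 0 i] partition_mono[OF p(3), of "Suc i" N] p(1,2)
      by (intro metric_piece_speed(1)[OF J fX p(4)]) auto
  qed auto
  then show ?thesis
  proof eventually_elim
    case (elim t)
    show ?case
    proof
      assume "t \<in> {a<..b}"
      then obtain i where "i < N" "t \<in> {p i<..p (Suc i)}" using partition_cover[of t p N] p(1,2) by auto
      then show "\<exists>l. ((\<lambda>s. J (f s) (f t) / \<bar>s - t\<bar>) \<longlongrightarrow> l) (at t within {a..b})"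
        using elim by auto
    qed
  qed
qed

text \<open>Induction along the partition: the relaxed triangle inequality through p n adds one
  piece, whose chord is crudely bounded by the whole length L, so K L becomes \<sigma> (K L + L).
  The constant is chosen before the path, as an infimum over paths requires.\<close>

lemma piecewise_paths_length_lower_bound:
  assumes J: "quasimetric X J" and "0 \<le> \<sigma>"
    and \<sigma>: "\<And>x y z. x \<in> X \<Longrightarrow> y \<in> X \<Longrightarrow> z \<in> X \<Longrightarrow> J x y \<le> \<sigma> * (J x z + J z y)"
  shows "\<exists>K<\<infinity>. \<forall>f \<in> piecewise_paths X J N a b. ennreal (J (f a) (f b)) \<le> K * path_length_J J a b f"
proof -
  define K where "K = rec_nat (0::ennreal) (\<lambda>_ k. ennreal \<sigma> * (k + 1))"
  have K: "K 0 = 0" "K (Suc n) = ennreal \<sigma> * (K n + 1)" for n by (auto simp: K_def)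
  have "K n < \<infinity>" for n by (induction n) (auto simp: K ennreal_mult_less_top)
  moreover have "ennreal (J (f a) (f b)) \<le> K N * path_length_J J a b f"
    if f: "f \<in> piecewise_paths X J N a b" for f
  proof -
    let ?L = "path_length_J J a b f"
    obtain p where p: "p 0 = a" "p N = b" "\<forall>i<N. p i < p (Suc i)"
        "\<And>i. i < N \<Longrightarrow> metric_piece J f (p i) (p (Suc i))" and fX: "f \<in> {a..b} \<rightarrow> X"
      using f unfolding piecewise_paths_iff qm_continuous_def by blast
    have pab: "p i \<in> {a..b}" if "i \<le> N" for i
      using partition_mono[OF p(3), of 0 i] partition_mono[OF p(3), of i N] p(1,2) that by auto
    have piece: "ennreal (J (f (p i)) (f (p (Suc i)))) \<le> ?L" if "i < N" for i
    proof -
      have ab: "a \<le> p i" "p (Suc i) \<le> b" using pab[of i] pab[of "Suc i"] that by auto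
      have "ennreal (J (f (p i)) (f (p (Suc i))))
          \<le> (\<integral>\<^sup>+t\<in>{p i..p (Suc i)}. ennreal (metric_speed J a b f t) \<partial>lebesgue)"
        using p(3) that ab by (intro metric_piece_speed(2)[OF J fX p(4)]) auto
      also have "\<dots> \<le> ?L"
        unfolding path_length_J_def using ab by (intro nn_integral_mono) (auto simp: indicator_def)
      finally show ?thesis .
    qed
    have "ennreal (J (f (p 0)) (f (p n))) \<le> K n * ?L" if "n \<le> N" for n
      using that
    proof (induction n)
      case 0
      have "f (p 0) \<in> X" using pab[of 0] fX by auto
      then show ?case using quasimetric_refl[OF J] by simp
    next
      case (Suc n)
      have X: "f (p i) \<in> X" if "i \<le> N" for i using pab[OF that] fX by auto
      have nn: "0 \<le> J (f (p i)) (f (p j))" if "i \<le> N" "j \<le> N" for i j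
        using X that by (intro quasimetric_nonneg[OF J]) auto
      have "J (f (p 0)) (f (p (Suc n))) \<le> \<sigma> * (J (f (p 0)) (f (p n)) + J (f (p n)) (f (p (Suc n))))"
        using Suc.prems by (intro \<sigma> X) auto
      then have "ennreal (J (f (p 0)) (f (p (Suc n))))
          \<le> ennreal \<sigma> * (ennreal (J (f (p 0)) (f (p n))) + ennreal (J (f (p n)) (f (p (Suc n)))))"
        using nn Suc.prems \<open>0 \<le> \<sigma>\<close>
        by (simp add: ennreal_plus[symmetric] ennreal_mult[symmetric] ennreal_leI del: ennreal_plus)
      also have "\<dots> \<le> ennreal \<sigma> * (K n * ?L + ?L)"
        using Suc piece[of n] by (intro mult_left_mono add_mono) auto
      also have "\<dots> = K (Suc n) * ?L" by (simp add: K algebra_simps)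
      finally show ?case .
    qed
    from this[of N] show ?thesis using p(1,2) by simp
  qed
  ultimately show ?thesis by blast
qed

section \<open>Reparametrizing, reversing and joining paths\<close>

text \<open>The chain rule gives |\<beta>| times the speed of f at \<alpha> + \<beta> t as the speed
  of h at t. Existence of the limit for h is assumed because \<open>Lim\<close> is arbitrary without
  it; the limit for f then follows.\<close>

lemma path_length_affine_le:
  fixes \<alpha> \<beta> :: real
  assumes lim: "AE t in lebesgue. t \<in> {0<..1} \<longrightarrow>
           (\<exists>l. ((\<lambda>s. J (h s) (h t) / \<bar>s - t\<bar>) \<longlongrightarrow> l) (at t within {0..1}))"
    and cd: "0 \<le> c" "d \<le> 1" and \<beta>: "\<beta> \<noteq> 0"
    and h: "\<And>s. s \<in> {c..d} \<Longrightarrow> h s = f (\<alpha> + \<beta> * s)"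
    and img: "\<And>s. s \<in> {c<..<d} \<Longrightarrow> \<alpha> + \<beta> * s \<in> {0<..<1}"
  shows "(\<integral>\<^sup>+t\<in>{c..d}. ennreal (metric_speed J 0 1 h t) \<partial>lebesgue) \<le> path_length_J J 0 1 f"
proof -
  define g where "g u = ennreal (metric_speed J 0 1 f u) * indicator {0..1} u" for u
  have ne: "AE t in lebesgue. t \<noteq> c \<and> t \<noteq> d"
    by (intro AE_conjI AE_I'[where N="{c}"] AE_I'[where N="{d}"]) (auto intro!: null_sets_completionI)
  have "(\<integral>\<^sup>+t\<in>{c..d}. ennreal (metric_speed J 0 1 h t) \<partial>lebesgue)
      \<le> (\<integral>\<^sup>+t. ennreal \<bar>\<beta>\<bar> * g (\<alpha> + \<beta> * t) \<partial>lebesgue)"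
  proof (rule nn_integral_mono_AE)
    show "AE t in lebesgue. ennreal (metric_speed J 0 1 h t) * indicator {c..d} t \<le> ennreal \<bar>\<beta>\<bar> * g (\<alpha> + \<beta> * t)"
      using lim ne
    proof eventually_elim
      case (elim t)
      show ?case
      proof (cases "t \<in> {c..d}")
        case True
        with elim have t: "t \<in> {c<..<d}" by auto
        then have t01: "0 < t" "t < 1" using cd by auto
        define u where "u = \<alpha> + \<beta> * t"
        have u: "0 < u" "u < 1" using img[OF t] by (auto simp: u_def)
        have at: "at t within {0..1} = at t" "at u within {0..1} = at u"
          using t01 u by (auto intro: at_within_Icc_at)
        obtain l where l: "((\<lambda>s. J (h s) (h t) / \<bar>s - t\<bar>) \<longlongrightarrow> l) (at t)"
          using elim(1) t01 by (auto simp: at)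
        \<comment> \<open>The inverse of the affine map, which transports the limit at t to a limit
          at u.\<close>
        define \<psi> where "\<psi> v = (v - \<alpha>) / \<beta>" for v
        have \<psi>u: "\<psi> u = t" using \<beta> by (simp add: \<psi>_def u_def)
        have \<psi>: "\<alpha> + \<beta> * \<psi> v = v" for v using \<beta> by (simp add: \<psi>_def)
        have \<psi>_lim: "filterlim \<psi> (at t) (at u)"
          unfolding filterlim_at
        proof
          have "(\<psi> \<longlongrightarrow> \<psi> u) (at u)" unfolding \<psi>_def using \<beta> by (intro tendsto_intros) auto
          then show "(\<psi> \<longlongrightarrow> t) (at u)" using \<psi>u by simp
          show "\<forall>\<^sub>F v in at u. \<psi> v \<in> UNIV \<and> \<psi> v \<noteq> t"
            using \<psi> by (auto simp: eventually_at_filter u_def intro!: always_eventually)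
        qed
        \<comment> \<open>The relation between h and f is known on {c..d} only, so \<psi> v has to
          stay in it near u.\<close>
        have "\<forall>\<^sub>F v in at u. \<psi> v \<in> {c<..<d}"
          using eventually_compose_filterlim[OF _ \<psi>_lim, of "\<lambda>s. s \<in> {c<..<d}"] t
          by (metis eventually_at_in_open' open_greaterThanLessThan)
        then have ev: "\<forall>\<^sub>F v in at u. J (h (\<psi> v)) (h t) / \<bar>\<psi> v - t\<bar> * inverse \<bar>\<beta>\<bar> = J (f v) (f u) / \<bar>v - u\<bar>"
        proof eventually_elim
          case (elim v)
          have "v - u = \<beta> * (\<psi> v - t)" by (simp add: u_def right_diff_distrib) (use \<psi>[of v] in linarith)
          then have "\<bar>v - u\<bar> = \<bar>\<beta>\<bar> * \<bar>\<psi> v - t\<bar>" by (simp add: abs_mult)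
          then show ?case using elim t h[of "\<psi> v"] h[of t] \<psi>[of v] by (simp add: u_def field_simps)
        qed
        have "((\<lambda>v. J (h (\<psi> v)) (h t) / \<bar>\<psi> v - t\<bar> * inverse \<bar>\<beta>\<bar>) \<longlongrightarrow> l * inverse \<bar>\<beta>\<bar>) (at u)"
          by (intro tendsto_mult filterlim_compose[OF l \<psi>_lim] tendsto_const)
        then have "((\<lambda>v. J (f v) (f u) / \<bar>v - u\<bar>) \<longlongrightarrow> l * inverse \<bar>\<beta>\<bar>) (at u)"
          using ev by (rule Lim_transform_eventually)
        then have "metric_speed J 0 1 f u = l * inverse \<bar>\<beta>\<bar>"
          by (simp add: metric_speed_def at tendsto_Lim)
        moreover have "metric_speed J 0 1 h t = l" using l by (simp add: metric_speed_def at tendsto_Lim)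
        ultimately have "metric_speed J 0 1 h t = \<bar>\<beta>\<bar> * metric_speed J 0 1 f u" using \<beta> by simp
        then have "ennreal (metric_speed J 0 1 h t) = ennreal \<bar>\<beta>\<bar> * ennreal (metric_speed J 0 1 f u)"
          by (simp add: ennreal_mult')
        then show ?thesis using u by (simp add: g_def u_def indicator_def)
      qed simp
    qed
  qed
  also have "\<dots> \<le> (\<integral>\<^sup>+u. g u \<partial>lebesgue)" by (rule nn_integral_real_affine_le[OF \<beta>])
  also have "\<dots> = path_length_J J 0 1 f" by (simp add: path_length_J_def g_def)
  finally show ?thesis .
qed

lemma paths_between_reverse:
  assumes J: "quasimetric X J" and f: "f \<in> paths_between X J N x y"
  shows "(\<lambda>t. f (1 - t)) \<in> paths_between X J N y x"
    and "path_length_J J 0 1 (\<lambda>t. f (1 - t)) \<le> path_length_J J 0 1 f"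
proof -
  obtain p where p: "p 0 = 0" "p N = 1" "\<And>i. i < N \<Longrightarrow> p i < p (Suc i)"
      "\<And>i. i < N \<Longrightarrow> metric_piece J f (p i) (p (Suc i))" and fX: "f \<in> {0..1} \<rightarrow> X"
      and xy: "f 0 = x" "f 1 = y"
    using f unfolding paths_between_def piecewise_paths_iff qm_continuous_def by blast
  have rev: "(\<lambda>t. f (1 - t)) \<in> piecewise_paths X J N 0 1"
  proof (rule piecewise_pathsI[OF J, where p="\<lambda>i. 1 - p (N - i)"])
    fix i assume i: "i < N"
    \<comment> \<open>Piece i of the reversed partition is the mirror image of piece N - Suc
      i.\<close>
    then have N: "N - i = Suc (N - Suc i)" "N - Suc i < N" by auto
    show "1 - p (N - i) < 1 - p (N - Suc i)" using p(3)[OF N(2)] N(1) by simp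
    show "metric_piece J (\<lambda>t. f (1 - t)) (1 - p (N - i)) (1 - p (N - Suc i))"
      using p(4)[OF N(2)] by (rule metric_piece_affine[where \<alpha>=1 and \<beta>="-1"]) (auto simp: N(1))
  qed (use fX p in auto)
  then show "(\<lambda>t. f (1 - t)) \<in> paths_between X J N y x"
    using xy by (simp add: paths_between_def)
  show "path_length_J J 0 1 (\<lambda>t. f (1 - t)) \<le> path_length_J J 0 1 f"
    unfolding path_length_J_def[of J 0 1 "\<lambda>t. f (1 - t)"]
    using piecewise_paths_speed_exists[OF J rev]
    by (rule path_length_affine_le[where \<alpha>=1 and \<beta>="-1"]) auto
qed

text \<open>The numbers of pieces add because the junction stays a break point: \<open>J\<close>
  need not satisfy the triangle inequality across y.\<close>

lemma paths_between_join:
  assumes J: "quasimetric X J" and f: "f \<in> paths_between X J N x y" and g: "g \<in> paths_between X J M y z"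
  defines "h \<equiv> \<lambda>t. if t \<le> 1 / 2 then f (2 * t) else g (2 * t - 1)"
  shows "h \<in> paths_between X J (N + M) x z"
    and "path_length_J J 0 1 h \<le> path_length_J J 0 1 f + path_length_J J 0 1 g"
proof -
  obtain p where p: "p 0 = 0" "p N = 1" "\<And>i. i < N \<Longrightarrow> p i < p (Suc i)"
      "\<And>i. i < N \<Longrightarrow> metric_piece J f (p i) (p (Suc i))" and fX: "f \<in> {0..1} \<rightarrow> X"
      and fxy: "f 0 = x" "f 1 = y"
    using f unfolding paths_between_def piecewise_paths_iff qm_continuous_def by blast
  obtain q where q: "q 0 = 0" "q M = 1" "\<And>i. i < M \<Longrightarrow> q i < q (Suc i)"
      "\<And>i. i < M \<Longrightarrow> metric_piece J g (q i) (q (Suc i))" and gX: "g \<in> {0..1} \<rightarrow> X"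
      and gyz: "g 0 = y" "g 1 = z"
    using g unfolding paths_between_def piecewise_paths_iff qm_continuous_def by blast
  have hf: "h t = f (0 + 2 * t)" if "t \<le> 1 / 2" for t using that by (simp add: h_def)
  \<comment> \<open>At 1 / 2 the definition of \<open>h\<close> picks f, but f 1 = y = g 0, so the
    formula with g holds on the closed half.\<close>
  have hg: "h t = g (- 1 + 2 * t)" if "1 / 2 \<le> t" for t
  proof (cases "t = 1 / 2")
    case True
    show ?thesis unfolding True using fxy gyz by (simp add: h_def)
  next
    case False
    then show ?thesis using that by (simp add: h_def)
  qed
  have p1: "p i \<le> 1" if "i \<le> N" for i using partition_mono[of N p i N] p that by auto
  have q0: "0 \<le> q i" if "i \<le> M" for i using partition_mono[of M q 0 i] q that by auto
  have h_path: "h \<in> piecewise_paths X J (N + M) 0 1"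
  proof (rule piecewise_pathsI[OF J, where p="\<lambda>i. if i \<le> N then p i / 2 else (q (i - N) + 1) / 2"])
    show "h \<in> {0..1} \<rightarrow> X"
      using fX gX by (auto simp: h_def Pi_iff)
    show "(if N + M \<le> N then p (N + M) / 2 else (q (N + M - N) + 1) / 2) = 1"
      using q(1,2) by (cases M) auto
  next
    let ?r = "\<lambda>i. if i \<le> N then p i / 2 else (q (i - N) + 1) / 2"
    fix i assume i: "i < N + M"
    \<comment> \<open>The index i = N belongs to both descriptions, since p N / 2 = 1 / 2 = (q 0 +
      1) / 2; hence the piece starting there lies entirely on the side of g.\<close>
    have r: "(i < N \<and> ?r i = p i / 2 \<and> ?r (Suc i) = p (Suc i) / 2) \<or>
      (i - N < M \<and> ?r i = (q (i - N) + 1) / 2 \<and> ?r (Suc i) = (q (Suc (i - N)) + 1) / 2)"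
      using i p(2) q(1) by (cases i N rule: linorder_cases) (auto simp: Suc_diff_le)
    then show "?r i < ?r (Suc i)" using p(3)[of i] q(3)[of "i - N"] by (elim disjE conjE) simp_all
    from r show "metric_piece J h (?r i) (?r (Suc i))"
    proof (elim disjE conjE)
      assume a: "i < N" "?r i = p i / 2" "?r (Suc i) = p (Suc i) / 2"
      show ?thesis unfolding a(2,3) using p(4)[OF a(1)]
        by (rule metric_piece_affine[where \<alpha>=0 and \<beta>=2]) (use p1[of "Suc i"] a(1) in \<open>auto simp: hf\<close>)
    next
      assume a: "i - N < M" "?r i = (q (i - N) + 1) / 2" "?r (Suc i) = (q (Suc (i - N)) + 1) / 2"
      show ?thesis unfolding a(2,3) using q(4)[OF a(1)]
      proof (rule metric_piece_affine)
        fix s assume s: "s \<in> {(q (i - N) + 1) / 2..(q (Suc (i - N)) + 1) / 2}"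
        then show "h s = g (- 1 + 2 * s)" using q0[of "i - N"] a(1) by (intro hg) auto
        show "- 1 + 2 * s \<in> {q (i - N)..q (Suc (i - N))}" using s by (auto simp: field_simps)
      qed
    qed
  qed (use p in auto)
  then show "h \<in> paths_between X J (N + M) x z"
    using hf[of 0] hg[of 1] fxy gyz by (simp add: paths_between_def)
  note lim = piecewise_paths_speed_exists[OF J h_path]
  have "path_length_J J 0 1 h = (\<integral>\<^sup>+t\<in>{0..1/2} \<union> {1/2..1}. ennreal (metric_speed J 0 1 h t) \<partial>lebesgue)"
    unfolding path_length_J_def by (intro nn_integral_cong) (auto simp: indicator_def)
  also have "\<dots> \<le> (\<integral>\<^sup>+t\<in>{0..1/2}. ennreal (metric_speed J 0 1 h t) \<partial>lebesgue)
      + (\<integral>\<^sup>+t\<in>{1/2..1}. ennreal (metric_speed J 0 1 h t) \<partial>lebesgue)"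
    by (rule nn_integral_Un_le) simp
  also have "\<dots> \<le> path_length_J J 0 1 f + path_length_J J 0 1 g"
  proof (rule add_mono)
    show "(\<integral>\<^sup>+t\<in>{0..1/2}. ennreal (metric_speed J 0 1 h t) \<partial>lebesgue) \<le> path_length_J J 0 1 f"
      using lim by (rule path_length_affine_le[where \<alpha>=0 and \<beta>=2]) (auto simp: hf)
    show "(\<integral>\<^sup>+t\<in>{1/2..1}. ennreal (metric_speed J 0 1 h t) \<partial>lebesgue) \<le> path_length_J J 0 1 g"
      using lim by (rule path_length_affine_le[where \<alpha>="-1" and \<beta>=2]) (auto simp: hg)
  qed
  finally show "path_length_J J 0 1 h \<le> path_length_J J 0 1 f + path_length_J J 0 1 g" .
qed

section \<open>The distances D^(N) and the metric D_J\<close>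

lemma path_dist_N_sym:
  assumes J: "quasimetric X J"
  shows "path_dist_N X J N x y = path_dist_N X J N y x"
proof -
  have "path_dist_N X J N y x \<le> path_dist_N X J N x y" for x y
    unfolding path_dist_N_def
  proof (rule INF_greatest)
    fix f assume "f \<in> paths_between X J N x y"
    note r = paths_between_reverse[OF J this]
    show "(INF f\<in>paths_between X J N y x. path_length_J J 0 1 f) \<le> path_length_J J 0 1 f"
      using INF_lower[OF r(1), of "path_length_J J 0 1"] r(2) by (rule order_trans)
  qed
  then show ?thesis by (intro antisym)
qed

text \<open>Subtracting a finite \<open>a\<close> moves it out of the infimum without an epsilon
  argument. An empty index set is covered, so pairs of points joined by no path with the given
  number of pieces need no separate treatment.\<close>

lemma ennreal_le_add_INF:
  fixes c a :: ennreal
  assumes "\<And>i. i \<in> I \<Longrightarrow> c \<le> a + f i"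
  shows "c \<le> a + (INF i\<in>I. f i)"
proof (cases "a = top")
  case False
  then have "c - a \<le> (INF i\<in>I. f i)"
    using assms by (intro INF_greatest) (simp add: ennreal_minus_le_iff)
  with False show ?thesis by (simp add: ennreal_minus_le_iff)
qed simp

lemma path_dist_N_triangle:
  assumes J: "quasimetric X J"
  shows "path_dist_N X J (N + M) x z \<le> path_dist_N X J N x y + path_dist_N X J M y z"
proof -
  have "path_dist_N X J (N + M) x z \<le> path_length_J J 0 1 f + path_length_J J 0 1 g"
    if "f \<in> paths_between X J N x y" "g \<in> paths_between X J M y z" for f g
    unfolding path_dist_N_def
    using INF_lower[OF paths_between_join(1)[OF J that], of "path_length_J J 0 1"]
      paths_between_join(2)[OF J that] by (rule order_trans)
  then have "path_dist_N X J (N + M) x z \<le> path_length_J J 0 1 f + path_dist_N X J M y z"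
    if "f \<in> paths_between X J N x y" for f
    unfolding path_dist_N_def[of X J M] using that by (intro ennreal_le_add_INF)
  then show ?thesis
    unfolding path_dist_N_def[of X J N] by (subst add.commute, intro ennreal_le_add_INF) (simp add: add.commute)
qed

text \<open>The constant path has speed 0. At least one piece is required, as [0, 1] has no
  partition into 0 pieces.\<close>

lemma path_dist_N_refl:
  assumes J: "quasimetric X J" and x: "x \<in> X"
  shows "path_dist_N X J (Suc N) x x = 0"
proof -
  have xx: "J x x = 0" using quasimetric_refl[OF J x] .
  have piece: "metric_piece J (\<lambda>_. x) c d" for c d
    unfolding metric_piece_def using xx by (auto intro: exI[of _ 0])
  have "(\<lambda>_. x) \<in> piecewise_paths X J (Suc N) 0 1"
    using x piece by (intro piecewise_pathsI[OF J, where p="\<lambda>i. real i / real (Suc N)"]) (auto simp: divide_strict_right_mono)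
  then have path: "(\<lambda>_. x) \<in> paths_between X J (Suc N) x x" by (simp add: paths_between_def)
  have "metric_speed J 0 1 (\<lambda>_. x) t = 0" if "t \<in> {0..1}" for t
  proof -
    \<comment> \<open>Limits are unique only along a nontrivial filter; this also covers the end
      points, where the limit is one-sided.\<close>
    have "at t within {0..1} \<noteq> bot" using that by (simp add: trivial_limit_within islimpt_Icc)
    then show ?thesis by (simp add: metric_speed_def xx tendsto_Lim)
  qed
  then have "path_length_J J 0 1 (\<lambda>_. x) = integral\<^sup>N lebesgue (\<lambda>t::real. 0)"
    unfolding path_length_J_def by (intro nn_integral_cong) (auto simp: indicator_def)
  then have "path_length_J J 0 1 (\<lambda>_. x) = 0" by simp
  then show ?thesis
    unfolding path_dist_N_def using INF_lower[OF path, of "path_length_J J 0 1"] by simp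
qed

lemma path_dist_N_eq_0D:
  assumes J: "quasimetric X J" and xy: "x \<in> X" "y \<in> X" and 0: "path_dist_N X J N x y = 0"
  shows "x = y"
proof -
  obtain \<sigma> where "1 \<le> \<sigma>" "\<And>x y z. x \<in> X \<Longrightarrow> y \<in> X \<Longrightarrow> z \<in> X \<Longrightarrow> J x y \<le> \<sigma> * (J x z + J z y)"
  proof -
    obtain \<sigma> where "1 \<le> \<sigma>" "\<forall>x\<in>X. \<forall>y\<in>X. \<forall>z\<in>X. J x y \<le> \<sigma> * (J x z + J z y)"
      using J unfolding quasimetric_def by (elim conjE exE)
    then show thesis by (intro that[of \<sigma>]) simp_all
  qed
  then obtain K where K: "K < \<infinity>"
      "\<forall>f \<in> piecewise_paths X J N 0 1. ennreal (J (f 0) (f 1)) \<le> K * path_length_J J 0 1 f"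
    using piecewise_paths_length_lower_bound[OF J, of \<sigma> N 0 1] by auto
  then obtain k where k: "K = ennreal k" "0 \<le> k" by (cases K) auto
  have "J x y \<le> 0"
  proof (rule ccontr)
    assume "\<not> J x y \<le> 0"
    \<comment> \<open>Makes k e < J x y, also when k = 0.\<close>
    define e where "e = J x y / (k + 1)"
    have "0 < e" using \<open>\<not> J x y \<le> 0\<close> k by (simp add: e_def)
    then have "path_dist_N X J N x y < ennreal e" using 0 by simp
    then obtain f where f: "f \<in> paths_between X J N x y" "path_length_J J 0 1 f < ennreal e"
      unfolding path_dist_N_def by (auto simp: INF_less_iff)
    have "ennreal (J x y) \<le> K * path_length_J J 0 1 f"
      using K(2) f(1) by (auto simp: paths_between_def)
    also have "\<dots> \<le> ennreal k * ennreal e"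
      unfolding k(1) using f(2) by (intro mult_left_mono) auto
    finally have "J x y \<le> k * e" using k(2) \<open>0 < e\<close> by (simp add: ennreal_mult[symmetric])
    also have "k * e < J x y" using k(2) \<open>0 < e\<close> by (simp add: e_def field_simps)
    finally show False by simp
  qed
  then have "J x y = 0" using quasimetric_nonneg[OF J xy] by simp
  then show ?thesis using J xy by (simp add: quasimetric_def)
qed

theorem proposition3p15:
  fixes X :: "'a set" and J :: "'a \<Rightarrow> 'a \<Rightarrow> real"
  assumes "perfect_quasimetric X J"
  shows "(\<forall>x\<in>X. \<forall>y\<in>X. path_dist X J x y < \<infinity>) \<and>
         Metric_space X (\<lambda>x y. enn2real (path_dist X J x y))"
proof -
  have J: "quasimetric X J" and fin: "\<And>x y. x \<in> X \<Longrightarrow> y \<in> X \<Longrightarrow> path_dist X J x y < \<infinity>"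
    and ev: "\<And>x y. x \<in> X \<Longrightarrow> y \<in> X \<Longrightarrow> \<forall>\<^sub>F N in sequentially. path_dist_N X J N x y = path_dist X J x y"
    using assms by (auto simp: perfect_quasimetric_def)
  have "Metric_space X (\<lambda>x y. enn2real (path_dist X J x y))"
  proof
    \<comment> \<open>\<open>Metric_space\<close> demands nonnegativity and symmetry for all points
      of the type, not just those of \<open>X\<close>.\<close>
    fix x y
    show "0 \<le> enn2real (path_dist X J x y)" by simp
    show "enn2real (path_dist X J x y) = enn2real (path_dist X J y x)"
      unfolding path_dist_def by (simp only: path_dist_N_sym[OF J, of _ x y])
  next
    fix x y assume xy: "x \<in> X" "y \<in> X"
    have "path_dist X J x y = 0 \<longleftrightarrow> x = y"
    proof
      assume 0: "path_dist X J x y = 0"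
      obtain N where "path_dist_N X J N x y = path_dist X J x y"
        using ev[OF xy] by (auto simp: eventually_sequentially)
      with 0 show "x = y" using path_dist_N_eq_0D[OF J xy] by simp
    next
      assume "x = y"
      moreover obtain N where "\<And>n. N \<le> n \<Longrightarrow> path_dist_N X J n x y = path_dist X J x y"
        using ev[OF xy] by (auto simp: eventually_sequentially)
      \<comment> \<open>A successor index is taken so that the constant path is admissible.\<close>
      then have "path_dist_N X J (Suc N) x y = path_dist X J x y" by simp
      ultimately show "path_dist X J x y = 0" using path_dist_N_refl[OF J xy(1), of N] by simp
    qed
    \<comment> \<open>Since \<open>enn2real\<close> also maps infinity to 0, finiteness is what lets
      a zero value pass back to \<open>path_dist\<close>.\<close>
    then show "(enn2real (path_dist X J x y) = 0) = (x = y)"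
      using fin[OF xy] by (auto simp: enn2real_eq_0_iff)
  next
    fix x y z assume xyz: "x \<in> X" "y \<in> X" "z \<in> X"
    \<comment> \<open>Two paths with N pieces join to one with N + N pieces. All three values are
      eventually constant, so a single large N yields the inequality.\<close>
    have "\<forall>\<^sub>F N in sequentially. path_dist_N X J (N + N) x z = path_dist X J x z"
      using ev[OF xyz(1,3)] by (auto simp: eventually_sequentially intro: trans_le_add1)
    with ev[OF xyz(1,2)] ev[OF xyz(2,3)]
    have "\<forall>\<^sub>F N in sequentially. path_dist X J x z \<le> path_dist X J x y + path_dist X J y z"
    proof eventually_elim
      case (elim N)
      then show ?case using path_dist_N_triangle[OF J, of N N x z y] by simp
    qed
    then have "path_dist X J x z \<le> path_dist X J x y + path_dist X J y z" by simp
    then have "enn2real (path_dist X J x z) \<le> enn2real (path_dist X J x y + path_dist X J y z)"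
      using fin xyz by (intro enn2real_mono) auto
    then show "enn2real (path_dist X J x z) \<le> enn2real (path_dist X J x y) + enn2real (path_dist X J y z)"
      using fin xyz by (simp add: enn2real_plus)
  qed
  then show ?thesis using fin by blast
qed

end
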